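(* Let $M$ be a compact manifold with a Riemannian metric $g_0$, let $\mathcal F$ be a (non-singular) Riemannian foliation on $(M,g_0)$ with totally geodesic leaves, and let $\phi:M\to\mathbb R$ be a basic function. Let $g_\phi$ be the metric defined by $$g_\phi(X+\xi,X+\xi)=g_0(X,X)+e^{2\phi}g_0(\xi,\xi)$$ for $X$ horizontal and $\xi$ vertical. If $\mathcal F$ has odd codimension, then $g_\phi$ has a nonpositively curved plane, i.e. there is a $2$-plane tangent to $M$ whose sectional curvature with respect to $g_\phi$ is nonpositive.
   Context: A foliation $\mathcal F$ on $(M,g_0)$ is Riemannian if its leaves are locally equidistant (equivalently, $\mathcal F$ is locally given by the fibers of a Riemannian submersion). All foliations are non-singular: all leaves have the same dimension. Vertical vectors are those tangent to the leaves; horizontal vectors are those $g_0$-orthogonal to the leaves. A basic function is a smooth function that is constant along the leaves. *)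

theory Defs
  imports "HOL-Analysis.Analysis" "HOL-Library.Disjoint_Sets"
begin

section \<open>Smooth maps on open sets\<close>

text \<open>Derivatives are two-sided, so the two notions below are meant for open \<open>S\<close> only.\<close>

primrec C_on :: "nat \<Rightarrow> 'a set \<Rightarrow> ('a::real_normed_vector \<Rightarrow> 'b::real_normed_vector) \<Rightarrow> bool" where
  "C_on 0 S f \<longleftrightarrow> continuous_on S f"
| "C_on (Suc k) S f \<longleftrightarrow> (\<forall>x\<in>S. f differentiable (at x)) \<and>
     (\<forall>v. C_on k S (\<lambda>x. frechet_derivative f (at x) v))"

definition smooth_on :: "'a set \<Rightarrow> ('a::real_normed_vector \<Rightarrow> 'b::real_normed_vector) \<Rightarrow> bool" where
  "smooth_on S f \<longleftrightarrow> (\<forall>k. C_on k S f)"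

section \<open>Smooth manifolds\<close>

text \<open>A chart is a pair of its domain and a map, whose values outside the domain are irrelevant.
  The dimension of the manifold is that of the model space \<open>'e\<close>.\<close>

type_synonym ('m, 'e) chart = "'m set \<times> ('m \<Rightarrow> 'e)"

definition is_chart :: "'m topology \<Rightarrow> ('m, 'e::euclidean_space) chart \<Rightarrow> bool" where
  "is_chart X c \<longleftrightarrow> openin X (fst c) \<and> open (snd c ` fst c) \<and>
     homeomorphic_map (subtopology X (fst c)) (top_of_set (snd c ` fst c)) (snd c)"

abbreviation chart_image :: "('m, 'e) chart \<Rightarrow> 'e set" where
  "chart_image c \<equiv> snd c ` fst c"

definition chart_inv :: "('m, 'e) chart \<Rightarrow> 'e \<Rightarrow> 'm" where
  "chart_inv c = inv_into (fst c) (snd c)"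

definition transition :: "('m, 'e) chart \<Rightarrow> ('m, 'e) chart \<Rightarrow> 'e \<Rightarrow> 'e" where
  "transition c d = snd d \<circ> chart_inv c"

definition compatible :: "('m, 'e::euclidean_space) chart \<Rightarrow> ('m, 'e) chart \<Rightarrow> bool" where
  "compatible c d \<longleftrightarrow> smooth_on (snd c ` (fst c \<inter> fst d)) (transition c d) \<and>
     smooth_on (snd d ` (fst c \<inter> fst d)) (transition d c)"

text \<open>The atlas is required to be maximal, that is, to be a smooth structure.\<close>

definition smooth_manifold :: "'m topology \<Rightarrow> ('m, 'e::euclidean_space) chart set \<Rightarrow> bool" where
  "smooth_manifold X A \<longleftrightarrow>
     Hausdorff_space X \<and> second_countable X \<and>
     (\<forall>c\<in>A. is_chart X c) \<and> (\<Union>c\<in>A. fst c) = topspace X \<and>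
     (\<forall>c\<in>A. \<forall>d\<in>A. compatible c d) \<and>
     (\<forall>c. is_chart X c \<and> (\<forall>d\<in>A. compatible c d) \<longrightarrow> c \<in> A)"

definition smooth_function :: "('m, 'e::euclidean_space) chart set \<Rightarrow> ('m \<Rightarrow> real) \<Rightarrow> bool" where
  "smooth_function A \<phi> \<longleftrightarrow> (\<forall>c\<in>A. smooth_on (chart_image c) (\<phi> \<circ> chart_inv c))"

section \<open>Riemannian metrics\<close>

definition metric_on :: "'e set \<Rightarrow> ('e::euclidean_space \<Rightarrow> 'e \<Rightarrow> 'e \<Rightarrow> real) \<Rightarrow> bool" where
  "metric_on S G \<longleftrightarrow>
     (\<forall>x\<in>S. bilinear (G x) \<and> (\<forall>v w. G x v w = G x w v) \<and> (\<forall>v. v \<noteq> 0 \<longrightarrow> G x v v > 0)) \<and>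
     (\<forall>v w. smooth_on S (\<lambda>x. G x v w))"

text \<open>A metric (tensor) on a manifold is given by its coordinate expressions: \<open>g c x v w\<close> is the
  value at the point with coordinates \<open>x\<close> in the chart \<open>c\<close> on the tangent vectors with components
  \<open>v\<close> and \<open>w\<close> in that chart. The last condition says that the expressions in different charts
  describe the same tensor.\<close>

type_synonym ('m, 'e) tensor2 = "('m, 'e) chart \<Rightarrow> 'e \<Rightarrow> 'e \<Rightarrow> 'e \<Rightarrow> real"

definition riemannian_metric ::
  "('m, 'e::euclidean_space) chart set \<Rightarrow> ('m, 'e) tensor2 \<Rightarrow> bool" where
  "riemannian_metric A g \<longleftrightarrow>
     (\<forall>c\<in>A. metric_on (chart_image c) (g c)) \<and>
     (\<forall>c\<in>A. \<forall>d\<in>A. \<forall>p\<in>fst c \<inter> fst d. \<forall>v w.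
        g d (snd d p) (frechet_derivative (transition c d) (at (snd c p)) v)
                      (frechet_derivative (transition c d) (at (snd c p)) w) = g c (snd c p) v w)"

text \<open>Below, \<open>G\<close> is a metric on an open subset of \<open>'e\<close>, and tangent vectors \<open>v\<close> are
  identified with constant (coordinate) vector fields, whose Lie brackets vanish.
  \<open>christoffel G x v w\<close> is \<open>\<Gamma>\<^sup>k\<^sub>i\<^sub>j v\<^sup>i w\<^sup>j\<close>, obtained from the Koszul formula.\<close>

definition christoffel ::
  "('e::euclidean_space \<Rightarrow> 'e \<Rightarrow> 'e \<Rightarrow> real) \<Rightarrow> 'e \<Rightarrow> 'e \<Rightarrow> 'e \<Rightarrow> 'e" where
  "christoffel G x v w = (THE u. \<forall>z. 2 * G x u z =
       frechet_derivative (\<lambda>y. G y w z) (at x) v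
     + frechet_derivative (\<lambda>y. G y v z) (at x) w
     - frechet_derivative (\<lambda>y. G y v w) (at x) z)"

definition cov_deriv ::
  "('e::euclidean_space \<Rightarrow> 'e \<Rightarrow> 'e \<Rightarrow> real) \<Rightarrow> ('e \<Rightarrow> 'e) \<Rightarrow> ('e \<Rightarrow> 'e) \<Rightarrow> 'e \<Rightarrow> 'e" where
  "cov_deriv G V W x = frechet_derivative W (at x) (V x) + christoffel G x (V x) (W x)"

text \<open>\<open>R(v,w)u = \<nabla>\<^sub>v \<nabla>\<^sub>w u - \<nabla>\<^sub>w \<nabla>\<^sub>v u\<close>, so that round spheres have positive curvature below.\<close>

definition curvature_tensor ::
  "('e::euclidean_space \<Rightarrow> 'e \<Rightarrow> 'e \<Rightarrow> real) \<Rightarrow> 'e \<Rightarrow> 'e \<Rightarrow> 'e \<Rightarrow> 'e \<Rightarrow> 'e" where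
  "curvature_tensor G x v w u =
     cov_deriv G (\<lambda>_. v) (cov_deriv G (\<lambda>_. w) (\<lambda>_. u)) x
   - cov_deriv G (\<lambda>_. w) (cov_deriv G (\<lambda>_. v) (\<lambda>_. u)) x"

text \<open>Sectional curvature of the plane spanned by linearly independent \<open>v\<close> and \<open>w\<close>.\<close>

definition sectional_curvature ::
  "('e::euclidean_space \<Rightarrow> 'e \<Rightarrow> 'e \<Rightarrow> real) \<Rightarrow> 'e \<Rightarrow> 'e \<Rightarrow> 'e \<Rightarrow> real" where
  "sectional_curvature G x v w =
     G x (curvature_tensor G x v w w) v / (G x v v * G x w w - (G x v w)\<^sup>2)"

section \<open>Foliations\<close>

text \<open>The model space is \<open>'v \<times> 'h\<close>, where \<open>'v\<close> has the dimension of the leaves and \<open>'h\<close> has the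
  codimension of the foliation. Since Euclidean spaces in the sense of the type class have positive
  dimension, the leaves are not points.

  A foliation is a partition of the manifold into path-connected sets (the leaves) such that, near
  every point, there are coordinates in which the local leaves (the path components of the
  intersections of the leaves with the chart domain) are the plaques, on which the \<open>'h\<close>-coordinate
  is constant.\<close>

definition foliated_chart :: "'m topology \<Rightarrow> 'm set set \<Rightarrow>
    ('m, 'v::euclidean_space \<times> 'h::euclidean_space) chart \<Rightarrow> bool" where
  "foliated_chart X F c \<longleftrightarrow> (\<forall>L\<in>F. \<forall>p\<in>fst c \<inter> L.
     path_component_of_set (subtopology X (fst c \<inter> L)) p
       = {q \<in> fst c. snd (snd c q) = snd (snd c p)})"

definition foliation :: "'m topology \<Rightarrow>
    ('m, 'v::euclidean_space \<times> 'h::euclidean_space) chart set \<Rightarrow> 'm set set \<Rightarrow> bool" where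
  "foliation X A F \<longleftrightarrow> partition_on (topspace X) F \<and> (\<forall>L\<in>F. path_connectedin X L) \<and>
     (\<forall>p\<in>topspace X. \<exists>c\<in>A. p \<in> fst c \<and> foliated_chart X F c)"

text \<open>The space of vertical vectors at the point with coordinates \<open>x\<close>, in components with respect
  to the chart \<open>c\<close>: the velocities of smooth curves in the leaf through this point.\<close>

definition vertical_space ::
  "'m set set \<Rightarrow> ('m, 'e::euclidean_space) chart \<Rightarrow> 'e \<Rightarrow> 'e set" where
  "vertical_space F c x = {v. \<exists>L\<in>F. \<exists>\<gamma> \<epsilon>. \<epsilon> > (0::real) \<and>
     \<gamma> ` {-\<epsilon><..<\<epsilon>} \<subseteq> snd c ` (fst c \<inter> L) \<and> smooth_on {-\<epsilon><..<\<epsilon>} \<gamma> \<and>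
     \<gamma> 0 = x \<and> (\<gamma> has_vector_derivative v) (at 0)}"

definition vertical_part :: "'m set set \<Rightarrow> ('m, 'e::euclidean_space) tensor2 \<Rightarrow>
    ('m, 'e) chart \<Rightarrow> 'e \<Rightarrow> 'e \<Rightarrow> 'e" where
  "vertical_part F g c x u =
     (THE \<xi>. \<xi> \<in> vertical_space F c x \<and> (\<forall>\<eta>\<in>vertical_space F c x. g c x (u - \<xi>) \<eta> = 0))"

definition horizontal_part :: "'m set set \<Rightarrow> ('m, 'e::euclidean_space) tensor2 \<Rightarrow>
    ('m, 'e) chart \<Rightarrow> 'e \<Rightarrow> 'e \<Rightarrow> 'e" where
  "horizontal_part F g c x u = u - vertical_part F g c x u"

text \<open>For an open set \<open>S\<close> with a metric \<open>G\<close>, and a metric \<open>H\<close> on a neighbourhood of the image.\<close>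

definition riemannian_submersion :: "'e set \<Rightarrow> ('e::euclidean_space \<Rightarrow> 'e \<Rightarrow> 'e \<Rightarrow> real) \<Rightarrow>
    ('b::euclidean_space \<Rightarrow> 'b \<Rightarrow> 'b \<Rightarrow> real) \<Rightarrow> ('e \<Rightarrow> 'b) \<Rightarrow> bool" where
  "riemannian_submersion S G H \<pi> \<longleftrightarrow> smooth_on S \<pi> \<and>
     (\<forall>x\<in>S. let P = frechet_derivative \<pi> (at x); K = {k. P k = 0} in
        range P = UNIV \<and>
        (\<forall>u w. (\<forall>k\<in>K. G x u k = 0) \<and> (\<forall>k\<in>K. G x w k = 0)
           \<longrightarrow> H (\<pi> x) (P u) (P w) = G x u w))"

text \<open>Locally, the leaves are the fibres of a Riemannian submersion; in suitable coordinates that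
  submersion is the projection \<open>snd\<close> of a foliated chart.\<close>

definition riemannian_foliation :: "'m topology \<Rightarrow>
    ('m, 'v::euclidean_space \<times> 'h::euclidean_space) chart set \<Rightarrow>
    ('m, 'v \<times> 'h) tensor2 \<Rightarrow> 'm set set \<Rightarrow> bool" where
  "riemannian_foliation X A g F \<longleftrightarrow> foliation X A F \<and>
     (\<forall>p\<in>topspace X. \<exists>c\<in>A. p \<in> fst c \<and> foliated_chart X F c \<and>
        (\<exists>H. metric_on (snd ` chart_image c) H \<and>
             riemannian_submersion (chart_image c) (g c) H snd))"

text \<open>The leaves are totally geodesic if their second fundamental forms, the horizontal parts of
  \<open>\<nabla>\<^sub>V W\<close> for vertical \<open>V\<close> and \<open>W\<close>, vanish.\<close>

definition vertical_field ::
  "'m set set \<Rightarrow> ('m, 'e::euclidean_space) chart \<Rightarrow> ('e \<Rightarrow> 'e) \<Rightarrow> bool" where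
  "vertical_field F c V \<longleftrightarrow> smooth_on (chart_image c) V \<and>
     (\<forall>x\<in>chart_image c. V x \<in> vertical_space F c x)"

definition totally_geodesic_leaves :: "('m, 'e::euclidean_space) chart set \<Rightarrow>
    ('m, 'e) tensor2 \<Rightarrow> 'm set set \<Rightarrow> bool" where
  "totally_geodesic_leaves A g F \<longleftrightarrow>
     (\<forall>c\<in>A. \<forall>V W. vertical_field F c V \<and> vertical_field F c W \<longrightarrow>
        (\<forall>x\<in>chart_image c. horizontal_part F g c x (cov_deriv (g c) V W x) = 0))"

definition basic_function :: "('m, 'e::euclidean_space) chart set \<Rightarrow> 'm set set \<Rightarrow>
    ('m \<Rightarrow> real) \<Rightarrow> bool" where
  "basic_function A F \<phi> \<longleftrightarrow> smooth_function A \<phi> \<and> (\<forall>L\<in>F. \<forall>p\<in>L. \<forall>q\<in>L. \<phi> p = \<phi> q)"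

text \<open>The symmetric bilinear form with the quadratic form
  \<open>X + \<xi> \<mapsto> g(X,X) + e\<^sup>2\<^sup>\<phi> g(\<xi>,\<xi>)\<close>, for \<open>X\<close> horizontal and \<open>\<xi>\<close> vertical.\<close>

definition warped_metric :: "'m set set \<Rightarrow> ('m, 'e::euclidean_space) tensor2 \<Rightarrow>
    ('m \<Rightarrow> real) \<Rightarrow> ('m, 'e) tensor2" where
  "warped_metric F g \<phi> c x u w =
     g c x (horizontal_part F g c x u) (horizontal_part F g c x w)
   + exp (2 * \<phi> (chart_inv c x)) * g c x (vertical_part F g c x u) (vertical_part F g c x w)"

end

theory Submission
  imports Defs
begin

text \<open>The function \<open>\<phi>\<close> attains its minimum at some point \<open>p\<close>. For a vertical \<open>w\<close> at \<open>p\<close>, O'Neill's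
  integrability tensor \<open>(v, z) \<mapsto> g(\<nabla>\<^sub>v z, w)\<close> is a skew form on the horizontal space, which has odd
  dimension; so it has a nonzero \<open>v\<close> in its kernel. As \<open>d\<phi>\<close> vanishes at \<open>p\<close> and the leaves are totally
  geodesic for the original metric, the numerator \<open>g\<^sub>\<phi>(R(v,w)w,v)\<close> reduces to a negative multiple of
  the Hessian of \<open>\<phi>\<close> in the direction \<open>v\<close>, which is nonnegative at a minimum. The calculation is
  done in the coordinates of a foliated chart.\<close>

section \<open>Calculus of differentiability classes\<close>

text \<open>For a Riemannian submersion with totally geodesic fibres, a plane spanned by a
  horizontal \<open>v\<close> and a vertical \<open>w\<close> has curvature \<open>|A_v w|^2\<close>
  up to normalisation, which is never negative. Warping adds minus the squared length of
  \<open>w\<close> times \<open>Hess \<phi>(v, v) + (d\<phi> v)^2\<close>, which at a minimum has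
  the right sign, provided that the first term is made to vanish; this is the role of parity. The
  obstacle is that curvature is expressed through constant coordinate fields. The constant extension
  of \<open>v\<close> is not horizontal away from the minimum: its vertical part
  \<open>p y v\<close> vanishes there, but its derivatives do not. They enter every piece of the
  curvature and cancel only in the sum. In a foliated chart the metric is
  \<open>f \<kappa>(p, p) + h\<close> with \<open>f = exp (2 \<phi>)\<close>; the pulled back metric
  \<open>h\<close> is constant along the leaves and blind to vertical vectors, and contributes
  nothing to the final numerator. Moreover the Christoffel symbols and the vertical projection are
  given only implicitly, by linear equations, so their differentiability has to be derived from that
  of the coefficients.\<close>

definition dird :: "'a::real_normed_vector \<Rightarrow> ('a \<Rightarrow> 'b::real_normed_vector) \<Rightarrow> 'a \<Rightarrow> 'b" where
  "dird v f x = frechet_derivative f (at x) v"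

text \<open>Replaces the defining equation, removed from the simpset below, so that higher
  derivatives appear as iterated \<open>dird\<close>.\<close>

lemma C_on_Suc_dird:
  "C_on (Suc k) S f \<longleftrightarrow> (\<forall>x\<in>S. f differentiable (at x)) \<and> (\<forall>v. C_on k S (dird v f))"
  by (simp add: dird_def[abs_def])

declare C_on.simps(2) [simp del]

lemma dird_eqI: "(f has_derivative f') (at x) \<Longrightarrow> dird v f x = f' v"
  by (metis dird_def frechet_derivative_at)

lemma has_derivative_dird:
  "f differentiable (at x) \<Longrightarrow> (f has_derivative (\<lambda>v. dird v f x)) (at x)"
  unfolding dird_def by (simp add: frechet_derivative_works)

lemma linear_dird: "f differentiable (at x) \<Longrightarrow> linear (\<lambda>v. dird v f x)"
  using has_derivative_dird has_derivative_linear by blast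

text \<open>Differentiability is not assumed: functions that agree near \<open>x\<close> have the
  same candidates for a derivative, hence the same choice in
  \<open>frechet_derivative\<close>.\<close>

lemma dird_cong:
  assumes "open S" "x \<in> S" "\<And>y. y \<in> S \<Longrightarrow> f y = g y"
  shows "dird v f x = dird v g x"
proof -
  have "(f has_derivative f') (at x) \<longleftrightarrow> (g has_derivative f') (at x)" for f'
    using assms has_derivative_transform_within_open[of f f' x UNIV S g]
      has_derivative_transform_within_open[of g f' x UNIV S f] by auto
  then show ?thesis unfolding dird_def frechet_derivative_def by simp
qed

lemma differentiable_cong_open:
  assumes "open S" "x \<in> S" "\<And>y. y \<in> S \<Longrightarrow> f y = g y"
  shows "f differentiable (at x) \<longleftrightarrow> g differentiable (at x)"
  using assms has_derivative_transform_within_open[of f _ x UNIV S g]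
      has_derivative_transform_within_open[of g _ x UNIV S f] unfolding differentiable_def by metis

lemma dird_const [simp]: "dird v (\<lambda>_. c) x = 0"
  by (rule dird_eqI) simp

lemma dird_add:
  assumes "f differentiable (at x)" "g differentiable (at x)"
  shows "dird v (\<lambda>y. f y + g y) x = dird v f x + dird v g x"
  by (rule dird_eqI) (intro derivative_intros has_derivative_dird assms)

lemma dird_diff:
  assumes "f differentiable (at x)" "g differentiable (at x)"
  shows "dird v (\<lambda>y. f y - g y) x = dird v f x - dird v g x"
  by (rule dird_eqI) (intro derivative_intros has_derivative_dird assms)

lemma (in bounded_bilinear) dird_prod:
  assumes "f differentiable (at x)" "g differentiable (at x)"
  shows "dird v (\<lambda>y. prod (f y) (g y)) x = prod (f x) (dird v g x) + prod (dird v f x) (g x)"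
  by (rule dird_eqI) (intro FDERIV has_derivative_dird assms)

lemmas dird_mult = bounded_bilinear.dird_prod[OF bounded_bilinear_mult]
lemma (in bounded_linear) dird_linear:
  assumes "g differentiable (at x)"
  shows "dird v (\<lambda>y. f (g y)) x = f (dird v g x)"
  by (rule dird_eqI) (intro has_derivative has_derivative_dird assms)

lemma dird_cmult:
  fixes f :: "'a::real_normed_vector \<Rightarrow> real"
  assumes "f differentiable (at x)"
  shows "dird v (\<lambda>y. c * f y) x = c * dird v f x"
  by (rule bounded_linear.dird_linear[OF bounded_linear_mult_right assms])

lemma C_on_cong:
  assumes "open S" "\<And>y. y \<in> S \<Longrightarrow> f y = g y"
  shows "C_on k S f \<longleftrightarrow> C_on k S g"
  using assms(2)
proof (induction k arbitrary: f g)
  case 0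
  then show ?case by (simp cong: continuous_on_cong)
next
  case (Suc k)
  have "dird v f x = dird v g x" if "x \<in> S" for v x
    using assms(1) that Suc.prems by (rule dird_cong)
  then have "C_on k S (dird v f) \<longleftrightarrow> C_on k S (dird v g)" for v
    by (rule Suc.IH)
  then show ?case
    unfolding C_on_Suc_dird using differentiable_cong_open[OF assms(1) _ Suc.prems] by simp
qed

lemmas C_on_congI = C_on_cong[THEN iffD2, rotated 2]

lemma C_on_Suc_differentiable: "C_on (Suc k) S f \<Longrightarrow> x \<in> S \<Longrightarrow> f differentiable (at x)"
  by (simp add: C_on_Suc_dird)

lemma C_on_dird: "C_on (Suc k) S f \<Longrightarrow> C_on k S (dird v f)"
  by (simp add: C_on_Suc_dird)

lemma C_on_SucD: "C_on (Suc k) S f \<Longrightarrow> C_on k S f"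
proof (induction k arbitrary: f)
  case 0
  then show ?case
    by (auto simp: C_on_Suc_dird intro!: continuous_at_imp_continuous_on differentiable_imp_continuous_within)
next
  case (Suc k)
  then show ?case by (auto simp: C_on_Suc_dird[of "Suc k"] C_on_Suc_dird[of k])
qed

lemma C_on_continuous_on: "C_on k S f \<Longrightarrow> continuous_on S f"
  by (induction k) (simp, blast dest: C_on_SucD)

lemma C_on_const: "C_on k S (\<lambda>_. c)"
proof (induction k arbitrary: c)
  case (Suc k)
  have "dird v (\<lambda>_. c) = (\<lambda>_. 0)" for v :: 'a by (simp add: fun_eq_iff)
  then show ?case using Suc by (simp add: C_on_Suc_dird)
qed simp

lemma C_on_add:
  assumes "open S" "C_on k S f" "C_on k S g"
  shows "C_on k S (\<lambda>x. f x + g x)"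
  using assms(2,3)
proof (induction k arbitrary: f g)
  case 0
  then show ?case by (simp add: continuous_on_exp continuous_on_add)
next
  case (Suc k)
  have "C_on k S (dird v (\<lambda>x. f x + g x))" for v
  proof -
    have "C_on k S (\<lambda>x. dird v f x + dird v g x)"
      using Suc by (intro Suc.IH C_on_dird)
    then show ?thesis
      by (rule C_on_congI[OF _ assms(1)]) (intro dird_add C_on_Suc_differentiable[OF Suc.prems(1)]
          C_on_Suc_differentiable[OF Suc.prems(2)])
  qed
  then show ?case using Suc.prems by (auto simp: C_on_Suc_dird)
qed

lemma C_on_sum:
  assumes "open S" "\<And>i. i \<in> I \<Longrightarrow> C_on k S (f i)"
  shows "C_on k S (\<lambda>x. \<Sum>i\<in>I. f i x)"
  using assms(2) by (induction I rule: infinite_finite_induct) (auto simp: C_on_const C_on_add[OF assms(1)])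

lemma (in bounded_linear) C_on_linear:
  assumes "open S" "C_on k S g"
  shows "C_on k S (\<lambda>x. f (g x))"
  using assms(2)
proof (induction k arbitrary: g)
  case 0
  then show ?case by (simp add: continuous_on)
next
  case (Suc k)
  have "C_on k S (dird v (\<lambda>x. f (g x)))" for v
    by (rule C_on_congI[OF Suc.IH[OF C_on_dird[where v=v]] assms(1)], rule Suc.prems)
      (intro dird_linear C_on_Suc_differentiable[OF Suc.prems])
  moreover have "(\<lambda>x. f (g x)) differentiable (at x)" if "x \<in> S" for x
    using has_derivative[OF has_derivative_dird[OF C_on_Suc_differentiable[OF Suc.prems that]]]
    unfolding differentiable_def by blast
  ultimately show ?case by (auto simp: C_on_Suc_dird)
qed

lemma (in bounded_bilinear) C_on_prod:
  assumes "open S" "C_on k S f" "C_on k S g"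
  shows "C_on k S (\<lambda>x. prod (f x) (g x))"
  using assms(2,3)
proof (induction k arbitrary: f g)
  case 0
  then show ?case by (simp add: continuous_on)
next
  case (Suc k)
  have "C_on k S (dird v (\<lambda>x. prod (f x) (g x)))" for v
  proof -
    have "C_on k S (\<lambda>x. prod (f x) (dird v g x) + prod (dird v f x) (g x))"
      by (rule C_on_add[OF assms(1) Suc.IH[OF C_on_SucD[OF Suc.prems(1)] C_on_dird[OF Suc.prems(2)]]
          Suc.IH[OF C_on_dird[OF Suc.prems(1)] C_on_SucD[OF Suc.prems(2)]]])
    then show ?thesis
      by (rule C_on_congI[OF _ assms(1)]) (intro dird_prod C_on_Suc_differentiable[OF Suc.prems(1)]
          C_on_Suc_differentiable[OF Suc.prems(2)])
  qed
  moreover have "(\<lambda>x. prod (f x) (g x)) differentiable (at x)" if "x \<in> S" for x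
    using FDERIV[OF has_derivative_dird[OF C_on_Suc_differentiable[OF Suc.prems(1) that]]
        has_derivative_dird[OF C_on_Suc_differentiable[OF Suc.prems(2) that]]]
    unfolding differentiable_def by blast
  ultimately show ?case by (auto simp: C_on_Suc_dird)
qed

lemmas C_on_mult = bounded_bilinear.C_on_prod[OF bounded_bilinear_mult]
lemmas C_on_scaleR = bounded_bilinear.C_on_prod[OF bounded_bilinear_scaleR]

lemma C_on_diff:
  assumes "open S" "C_on k S f" "C_on k S g"
  shows "C_on k S (\<lambda>x. f x - g x)"
  using C_on_add[OF assms(1,2) bounded_linear.C_on_linear[OF bounded_linear_minus[OF bounded_linear_ident] assms(1,3)]]
  by simp

text \<open>The induction runs with a fixed \<open>f\<close>, because differentiating
  \<open>exp (f x)\<close> returns the same function times a derivative of \<open>f\<close>.\<close>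

lemma C_on_exp:
  fixes f :: "'a::real_normed_vector \<Rightarrow> real"
  assumes "open S" "C_on k S f"
  shows "C_on k S (\<lambda>x. exp (f x))"
  using assms(2)
proof (induction k)
  case 0
  then show ?case by (simp add: continuous_on_exp continuous_on_add)
next
  case (Suc k)
  have d: "((\<lambda>x. exp (f x)) has_derivative (\<lambda>v. exp (f x) * dird v f x)) (at x)" if "x \<in> S" for x
    using has_derivative_exp[OF has_derivative_dird[OF C_on_Suc_differentiable[OF Suc.prems that]]]
    by (simp add: mult.commute)
  have "C_on k S (dird v (\<lambda>x. exp (f x)))" for v
  proof -
    have "C_on k S (\<lambda>x. exp (f x) * dird v f x)"
      by (rule C_on_mult[OF assms(1) Suc.IH[OF C_on_SucD[OF Suc.prems]] C_on_dird[OF Suc.prems]])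
    then show ?thesis
      by (rule C_on_congI[OF _ assms(1)]) (rule dird_eqI[OF d])
  qed
  then show ?case using d by (auto simp: C_on_Suc_dird differentiable_def)
qed

section \<open>Leibniz rules for families of linear and bilinear maps\<close>

lemma linear_Basis_expand:
  fixes L :: "'a::euclidean_space \<Rightarrow> 'b::real_vector"
  assumes "linear L"
  shows "L u = (\<Sum>b\<in>Basis. (u \<bullet> b) *\<^sub>R L b)"
  using linear_sum[OF assms, of "\<lambda>b. (u \<bullet> b) *\<^sub>R b" Basis] linear_cmul[OF assms]
  by (simp add: euclidean_representation)

text \<open>The family is known to be differentiable only at each fixed vector. Expanding
  \<open>U y\<close> in the finite basis reduces the claim to the product rule for scalars.\<close>

lemma has_derivative_linear_family:
  fixes L :: "'e::real_normed_vector \<Rightarrow> 'a::euclidean_space \<Rightarrow> 'b::real_normed_vector"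
  assumes "open S" "x \<in> S" "\<And>y. y \<in> S \<Longrightarrow> linear (L y)"
    and L: "\<And>u. (\<lambda>y. L y u) differentiable (at x)" and U: "U differentiable (at x)"
  shows "((\<lambda>y. L y (U y)) has_derivative
    (\<lambda>v. dird v (\<lambda>y. L y (U x)) x + L x (dird v U x))) (at x)"
proof -
  have E: "L y w = (\<Sum>b\<in>Basis. (w \<bullet> b) *\<^sub>R L y b)" if "y \<in> S" for y w
    using linear_Basis_expand assms(3) that by blast
  have *: "((\<lambda>y. L y (U y)) has_derivative
    (\<lambda>v. \<Sum>b\<in>Basis. (U x \<bullet> b) *\<^sub>R dird v (\<lambda>y. L y b) x + (dird v U x \<bullet> b) *\<^sub>R L x b)) (at x)"
    if U: "U differentiable (at x)" for U
  proof (rule has_derivative_transform_within_open[OF _ assms(1,2)])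
    show "((\<lambda>y. \<Sum>b\<in>Basis. (U y \<bullet> b) *\<^sub>R L y b) has_derivative
      (\<lambda>v. \<Sum>b\<in>Basis. (U x \<bullet> b) *\<^sub>R dird v (\<lambda>y. L y b) x + (dird v U x \<bullet> b) *\<^sub>R L x b)) (at x)"
      by (intro has_derivative_sum has_derivative_scaleR has_derivative_inner_left has_derivative_dird[OF U]
          has_derivative_dird[OF L])
  qed (simp add: E)
  \<comment> \<open>The formula just shown, for the constant function \<open>U x\<close>, identifies
    the first half of the sum.\<close>
  have "dird v (\<lambda>y. L y (U x)) x = (\<Sum>b\<in>Basis. (U x \<bullet> b) *\<^sub>R dird v (\<lambda>y. L y b) x)" for v
    using dird_eqI[OF *[of "\<lambda>_. U x"]] by simp
  then show ?thesis
    using *[OF U] E[OF assms(2), of "dird _ U x"] by (simp add: sum.distrib)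
qed

lemma C_on_linear_family:
  fixes L :: "'e::real_normed_vector \<Rightarrow> 'a::euclidean_space \<Rightarrow> 'b::real_normed_vector"
  assumes "open S" "\<And>y. y \<in> S \<Longrightarrow> linear (L y)" "\<And>u. C_on k S (\<lambda>y. L y u)" "C_on k S U"
  shows "C_on k S (\<lambda>y. L y (U y))"
proof -
  have "C_on k S (\<lambda>y. \<Sum>b\<in>Basis. (U y \<bullet> b) *\<^sub>R L y b)"
    by (intro C_on_sum C_on_scaleR assms bounded_linear.C_on_linear[OF bounded_linear_inner_left])
  then show ?thesis
    by (rule C_on_congI[OF _ assms(1)]) (rule linear_Basis_expand[OF assms(2)])
qed

lemma linear_dird_family:
  assumes "open S" "x \<in> S" "\<And>y. y \<in> S \<Longrightarrow> linear (L y)"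
    and "\<And>u. (\<lambda>y. L y u) differentiable (at x)"
  shows "linear (\<lambda>u. dird v (\<lambda>y. L y u) x)"
proof (rule linearI)
  fix u w and r :: real
  have "dird v (\<lambda>y. L y (u + w)) x = dird v (\<lambda>y. L y u + L y w) x"
    using assms by (intro dird_cong[OF assms(1,2)]) (simp add: linear_add)
  then show "dird v (\<lambda>y. L y (u + w)) x = dird v (\<lambda>y. L y u) x + dird v (\<lambda>y. L y w) x"
    by (simp add: dird_add assms)
  have "dird v (\<lambda>y. L y (r *\<^sub>R u)) x = dird v (\<lambda>y. r *\<^sub>R L y u) x"
    using assms by (intro dird_cong[OF assms(1,2)]) (simp add: linear_cmul)
  then show "dird v (\<lambda>y. L y (r *\<^sub>R u)) x = r *\<^sub>R dird v (\<lambda>y. L y u) x"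
    by (simp add: bounded_linear.dird_linear[OF bounded_linear_scaleR_right] assms)
qed

text \<open>The linear case is applied twice: to \<open>B y _ w\<close> with \<open>w\<close>
  frozen, then to the linear family \<open>B y (U y)\<close>.\<close>

lemma has_derivative_bilinear_family:
  fixes B :: "'e::real_normed_vector \<Rightarrow> 'a::euclidean_space \<Rightarrow> 'b::euclidean_space \<Rightarrow> 'c::real_normed_vector"
  assumes "open S" "x \<in> S" "\<And>y. y \<in> S \<Longrightarrow> bilinear (B y)"
    and B: "\<And>u w. (\<lambda>y. B y u w) differentiable (at x)"
    and U: "U differentiable (at x)" and W: "W differentiable (at x)"
  shows "((\<lambda>y. B y (U y) (W y)) has_derivative
    (\<lambda>v. dird v (\<lambda>y. B y (U x) (W x)) x + B x (dird v U x) (W x) + B x (U x) (dird v W x))) (at x)"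
proof -
  have lin: "linear (\<lambda>u. B y u w)" "linear (B y u)" if "y \<in> S" for y u w
    using assms(3)[OF that] by (simp_all add: bilinear_def)
  have 1: "((\<lambda>y. B y (U y) w) has_derivative
    (\<lambda>v. dird v (\<lambda>y. B y (U x) w) x + B x (dird v U x) w)) (at x)" for w
    by (rule has_derivative_linear_family[OF assms(1,2) lin(1) B U])
  then have 2: "(\<lambda>y. B y (U y) w) differentiable (at x)" for w
    unfolding differentiable_def by blast
  show ?thesis
    using has_derivative_linear_family[OF assms(1,2) lin(2) 2 W] unfolding dird_eqI[OF 1] .
qed

lemmas dird_bilinear_family = dird_eqI[OF has_derivative_bilinear_family]

lemma C_on_bilinear_family:
  fixes B :: "'e::real_normed_vector \<Rightarrow> 'a::euclidean_space \<Rightarrow> 'b::euclidean_space \<Rightarrow> 'c::real_normed_vector"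
  assumes "open S" "\<And>y. y \<in> S \<Longrightarrow> bilinear (B y)" "\<And>u w. C_on k S (\<lambda>y. B y u w)"
    and "C_on k S U" "C_on k S W"
  shows "C_on k S (\<lambda>y. B y (U y) (W y))"
proof (rule C_on_linear_family[OF assms(1) _ _ assms(5)])
  show "C_on k S (\<lambda>y. B y (U y) w)" for w
    using assms(2) by (intro C_on_linear_family[OF assms(1) _ assms(3,4)]) (simp add: bilinear_def)
qed (use assms(2) in \<open>simp add: bilinear_def\<close>)

section \<open>Smooth dependence of the solutions of linear equations\<close>

text \<open>The pointwise condition of \<open>metric_on\<close>, separated so that it also applies
  to the restriction of a metric to the leaves.\<close>

definition inner_form :: "('a::real_vector \<Rightarrow> 'a \<Rightarrow> real) \<Rightarrow> bool" where
  "inner_form B \<longleftrightarrow> bilinear B \<and> (\<forall>v w. B v w = B w v) \<and> (\<forall>v. v \<noteq> 0 \<longrightarrow> B v v > 0)"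

lemma inner_form_nonneg: "inner_form B \<Longrightarrow> B v v \<ge> 0"
  unfolding inner_form_def by (cases "v = 0") (auto simp: bilinear_lzero less_imp_le)

lemma inner_form_zeroD: "inner_form B \<Longrightarrow> B v v = 0 \<Longrightarrow> v = 0"
  unfolding inner_form_def by force

lemma inner_form_eqI:
  assumes "inner_form B" "\<And>z. B u z = B w z"
  shows "u = w"
proof -
  have "B (u - w) (u - w) = 0"
    using assms(1) bilinear_lsub[of B u w "u - w"] assms(2)[of "u - w"] by (simp add: inner_form_def)
  then show ?thesis using inner_form_zeroD[OF assms(1)] by fastforce
qed

text \<open>The endomorphism \<open>?T\<close> that expresses \<open>B\<close> through the standard
  inner product is injective by definiteness, hence surjective in finite dimension.\<close>

lemma inner_form_representation:
  fixes B :: "'a::euclidean_space \<Rightarrow> 'a \<Rightarrow> real"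
  assumes B: "inner_form B" and l: "linear l"
  shows "\<exists>u. \<forall>z. B u z = l z"
proof -
  have lin: "linear (\<lambda>u. B u z)" "linear (B u)" for u z
    using B by (simp_all add: inner_form_def bilinear_def)
  let ?T = "\<lambda>u. \<Sum>b\<in>Basis. B u b *\<^sub>R b"
  have "linear ?T"
    by (intro linear_compose_sum ballI linearI)
      (simp_all add: linear_add[OF lin(1)] linear_cmul[OF lin(1)] algebra_simps)
  moreover have T: "B u z = ?T u \<bullet> z" for u z
    by (subst linear_Basis_expand[OF lin(2)]) (simp add: inner_sum_left inner_commute[of z] mult.commute)
  then have "inj ?T"
    by (metis (no_types, lifting) injI inner_form_eqI[OF B])
  ultimately have "surj ?T"
    by (rule linear_injective_imp_surjective) simp
  then obtain u where u: "(\<Sum>b\<in>Basis. l b *\<^sub>R b) = ?T u"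
    unfolding surj_def by blast
  have "B u z = l z" for z
    unfolding T[of u z] u[symmetric]
    by (subst linear_Basis_expand[OF l]) (simp add: inner_sum_left inner_commute[of z] mult.commute)
  then show ?thesis by blast
qed

text \<open>\<open>m\<close> is the minimum of the quadratic form on the compact unit sphere;
  homogeneity does the rest.\<close>

lemma inner_form_coercive:
  fixes B :: "'a::euclidean_space \<Rightarrow> 'a \<Rightarrow> real"
  assumes B: "inner_form B"
  obtains m where "m > 0" "\<And>z. B z z \<ge> m * (norm z)\<^sup>2"
proof -
  have bl: "bilinear B" using B by (simp add: inner_form_def)
  have "continuous_on (sphere 0 1) (\<lambda>z. B z z)"
    using bilinear_continuous_on_compose[OF continuous_on_id continuous_on_id bl] by simp
  moreover have "sphere (0::'a) 1 \<noteq> {}" by simp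
  ultimately have "\<exists>z0\<in>sphere 0 1. \<forall>z\<in>sphere 0 1. B z0 z0 \<le> B z z"
    by (intro continuous_attains_inf compact_sphere)
  then obtain z0 where z0: "z0 \<in> sphere 0 1" "\<And>z. z \<in> sphere 0 1 \<Longrightarrow> B z0 z0 \<le> B z z"
    by blast
  have "B z z \<ge> B z0 z0 * (norm z)\<^sup>2" for z
  proof (cases "z = 0")
    case False
    let ?e = "(1 / norm z) *\<^sub>R z"
    have "B z z = (norm z)\<^sup>2 * B ?e ?e"
      using False by (simp add: bilinear_lmul[OF bl] bilinear_rmul[OF bl] power2_eq_square)
    moreover have "B z0 z0 \<le> B ?e ?e" using False by (intro z0) simp
    ultimately show ?thesis by (metis mult.commute mult_left_mono zero_le_power2)
  qed (simp add: bilinear_lzero[OF bl])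
  moreover have "B z0 z0 > 0" 
  proof -
    have "z0 \<noteq> 0" using z0(1) by auto
    then show ?thesis using B unfolding inner_form_def by blast
  qed
  ultimately show ?thesis using that by blast
qed

lemma linear_abs_le:
  fixes l :: "'a::euclidean_space \<Rightarrow> real"
  assumes "linear l"
  shows "\<bar>l z\<bar> \<le> (\<Sum>b\<in>Basis. \<bar>l b\<bar>) * norm z"
proof -
  have "\<bar>l z\<bar> \<le> (\<Sum>b\<in>Basis. \<bar>(z \<bullet> b) *\<^sub>R l b\<bar>)"
    by (subst linear_Basis_expand[OF assms]) (rule sum_abs)
  also have "\<dots> \<le> (\<Sum>b\<in>Basis. \<bar>l b\<bar> * norm z)"
    by (intro sum_mono) (simp add: abs_mult Basis_le_norm mult.commute[of _ "norm z"] mult_right_mono)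
  finally show ?thesis by (simp add: sum_distrib_right)
qed

text \<open>The constant is a sum over basis entries because families of forms are known to be
  continuous only entry by entry.\<close>

lemma bilinear_abs_le:
  fixes B :: "'a::euclidean_space \<Rightarrow> 'a \<Rightarrow> real"
  assumes "bilinear B"
  shows "\<bar>B u z\<bar> \<le> (\<Sum>b\<in>Basis. \<Sum>b'\<in>Basis. \<bar>B b b'\<bar>) * norm u * norm z"
proof -
  have lin: "linear (\<lambda>u. B u z)" "linear (B u)" for u z
    using assms by (simp_all add: bilinear_def)
  have "\<bar>B u z\<bar> \<le> (\<Sum>b\<in>Basis. \<bar>B b z\<bar>) * norm u"
    by (rule linear_abs_le[OF lin(1)])
  also have "\<dots> \<le> (\<Sum>b\<in>Basis. (\<Sum>b'\<in>Basis. \<bar>B b b'\<bar>) * norm z) * norm u"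
    by (intro mult_right_mono sum_mono linear_abs_le lin) simp
  finally show ?thesis by (simp add: sum_distrib_left sum_distrib_right mult_ac)
qed

text \<open>Coercivity of \<open>B x\<close> bounds the difference of two solutions by the
  perturbations \<open>\<delta>\<close> and \<open>\<epsilon>\<close> of the data, both of which
  tend to 0.\<close>

lemma continuous_on_inner_form_solution:
  fixes B :: "'e::real_normed_vector \<Rightarrow> 'a::euclidean_space \<Rightarrow> 'a \<Rightarrow> real"
  assumes B: "\<And>y. y \<in> S \<Longrightarrow> inner_form (B y)" and cB: "\<And>u w. continuous_on S (\<lambda>y. B y u w)"
    and l: "\<And>y. y \<in> S \<Longrightarrow> linear (l y)" and cl: "\<And>z. continuous_on S (\<lambda>y. l y z)"
    and u: "\<And>y z. y \<in> S \<Longrightarrow> B y (u y) z = l y z"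
  shows "continuous_on S u"
  unfolding continuous_on_def
proof
  fix x assume x: "x \<in> S"
  obtain m where m: "m > 0" "\<And>z. B x z z \<ge> m * (norm z)\<^sup>2"
    using inner_form_coercive[OF B[OF x]] by blast
  define \<delta> where "\<delta> y = (\<Sum>b\<in>Basis. \<bar>l y b - l x b\<bar>)" for y
  define \<epsilon> where "\<epsilon> y = (\<Sum>b\<in>Basis. \<Sum>b'\<in>Basis. \<bar>B y b b' - B x b b'\<bar>)" for y
  have "(\<delta> \<longlongrightarrow> (\<Sum>b\<in>Basis. \<bar>l x b - l x b\<bar>)) (at x within S)"
    unfolding \<delta>_def[abs_def] using cl x by (intro tendsto_intros) (simp add: continuous_on_def)
  then have \<delta>0: "(\<delta> \<longlongrightarrow> 0) (at x within S)" by simp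
  have "(\<epsilon> \<longlongrightarrow> (\<Sum>b\<in>Basis. \<Sum>b'\<in>Basis. \<bar>B x b b' - B x b b'\<bar>)) (at x within S)"
    unfolding \<epsilon>_def[abs_def] using cB x by (intro tendsto_intros) (simp add: continuous_on_def)
  then have \<epsilon>0: "(\<epsilon> \<longlongrightarrow> 0) (at x within S)" by simp
  have bound: "norm (u y - u x) \<le> (\<delta> y + \<epsilon> y * norm (u x)) / (m - \<epsilon> y)" if y: "y \<in> S" "\<epsilon> y < m" for y
  proof -
    let ?d = "u y - u x"
    have blx: "bilinear (B x)" and bly: "bilinear (B y)"
      using B x y by (auto simp: inner_form_def)
    then have bl: "bilinear (\<lambda>u z. B y u z - B x u z)"
      by (simp add: bilinear_def linear_compose_sub)
    have "m * (norm ?d)\<^sup>2 \<le> B x ?d ?d" by (rule m)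
    also have "\<dots> = (l y ?d - l x ?d) - (B y (u y) ?d - B x (u y) ?d)"
      using u[OF x] u[OF y(1)] by (simp add: bilinear_lsub[OF blx])
    also have "\<dots> \<le> \<delta> y * norm ?d + \<epsilon> y * norm (u y) * norm ?d"
      using linear_abs_le[OF linear_compose_sub[OF l[OF y(1)] l[OF x]], of ?d] bilinear_abs_le[OF bl, of "u y" ?d]
      unfolding \<delta>_def \<epsilon>_def by linarith
    finally have "norm ?d * (m * norm ?d) \<le> norm ?d * (\<delta> y + \<epsilon> y * norm (u y))"
      by (simp add: power2_eq_square algebra_simps)
    moreover have nn: "\<delta> y \<ge> 0" "\<epsilon> y \<ge> 0"
      unfolding \<delta>_def \<epsilon>_def by (auto intro!: sum_nonneg)
    ultimately have "m * norm ?d \<le> \<delta> y + \<epsilon> y * norm (u y)"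
      by (cases "?d = 0") simp_all
    \<comment> \<open>There is no a priori bound on \<open>u y\<close>; its part \<open>?d\<close>
      is absorbed on the left, which is possible once \<open>\<epsilon> y < m\<close>.\<close>
    also have "\<dots> \<le> \<delta> y + \<epsilon> y * (norm ?d + norm (u x))"
      using nn norm_triangle_sub[of "u y" "u x"] by (intro add_left_mono mult_left_mono) (auto simp: add.commute)
    finally show ?thesis using y by (simp add: field_simps)
  qed
  have "((\<lambda>y. (\<delta> y + \<epsilon> y * norm (u x)) / (m - \<epsilon> y)) \<longlongrightarrow> (0 + 0 * norm (u x)) / (m - 0)) (at x within S)"
    using m by (intro tendsto_intros \<delta>0 \<epsilon>0) simp
  then have lim: "((\<lambda>y. (\<delta> y + \<epsilon> y * norm (u x)) / (m - \<epsilon> y)) \<longlongrightarrow> 0) (at x within S)"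
    by simp
  have "((\<lambda>y. u y - u x) \<longlongrightarrow> 0) (at x within S)"
  proof (intro Lim_null_comparison[where f="\<lambda>y. u y - u x"])
    have "\<forall>\<^sub>F y in at x within S. \<epsilon> y < m" using \<epsilon>0 m(1) by (rule order_tendstoD)
    then show "\<forall>\<^sub>F y in at x within S. norm (u y - u x) \<le> (\<delta> y + \<epsilon> y * norm (u x)) / (m - \<epsilon> y)"
      by (rule eventually_mp[rotated]) (simp add: eventually_at_filter bound)
  qed (rule lim)
  then show "(u \<longlongrightarrow> u x) (at x within S)" by (rule LIM_zero_cancel)
qed

text \<open>Only continuity of \<open>c\<close> is needed, because \<open>h\<close> vanishes at \<open>x\<close>.\<close>

lemma has_derivative_mult_vanishing:
  fixes c h :: "'e::real_normed_vector \<Rightarrow> real"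
  assumes c: "isCont c x" and h: "(h has_derivative h') (at x)" and "h x = 0"
  shows "((\<lambda>y. c y * h y) has_derivative (\<lambda>v. c x * h' v)) (at x)"
proof -
  obtain K where K: "K > 0" "\<And>v. norm (h' v) \<le> norm v * K"
    using bounded_linear.pos_bounded[OF has_derivative_bounded_linear[OF h]] by blast
  have lim: "((\<lambda>y. norm (h y - h x - h' (y - x)) / norm (y - x)) \<longlongrightarrow> 0) (at x)"
    using h unfolding has_derivative_iff_norm by simp
  have "((\<lambda>y. \<bar>c y\<bar> * (norm (h y - h x - h' (y - x)) / norm (y - x)) + \<bar>c y - c x\<bar> * K)
      \<longlongrightarrow> \<bar>c x\<bar> * 0 + \<bar>c x - c x\<bar> * K) (at x)"
    using c by (intro tendsto_intros lim) (simp_all add: isCont_def)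
  then have lim2: "((\<lambda>y. \<bar>c y\<bar> * (norm (h y - h x - h' (y - x)) / norm (y - x)) + \<bar>c y - c x\<bar> * K)
      \<longlongrightarrow> 0) (at x)" by simp
  show ?thesis
    unfolding has_derivative_iff_norm
  proof
    show "bounded_linear (\<lambda>v. c x * h' v)"
      by (rule bounded_linear_const_mult[OF has_derivative_bounded_linear[OF h]])
    show "((\<lambda>y. norm (c y * h y - c x * h x - c x * h' (y - x)) / norm (y - x)) \<longlongrightarrow> 0) (at x)"
    proof (rule Lim_null_comparison[OF _ lim2], intro always_eventually allI)
      fix y
      have "c y * h y - c x * h x - c x * h' (y - x)
          = c y * (h y - h x - h' (y - x)) + (c y - c x) * h' (y - x)"
        using assms(3) by (simp add: algebra_simps)
      then have "norm (c y * h y - c x * h x - c x * h' (y - x))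
          \<le> \<bar>c y\<bar> * norm (h y - h x - h' (y - x)) + \<bar>c y - c x\<bar> * (norm (y - x) * K)"
        using norm_triangle_ineq[of "c y * (h y - h x - h' (y - x))" "(c y - c x) * h' (y - x)"]
          mult_left_mono[OF K(2), of "\<bar>c y - c x\<bar>" "y - x"] by (simp add: abs_mult)
      then have "norm (c y * h y - c x * h x - c x * h' (y - x)) / norm (y - x)
          \<le> (\<bar>c y\<bar> * norm (h y - h x - h' (y - x)) + \<bar>c y - c x\<bar> * (norm (y - x) * K)) / norm (y - x)"
        by (rule divide_right_mono) simp
      also have "\<dots> \<le> \<bar>c y\<bar> * (norm (h y - h x - h' (y - x)) / norm (y - x)) + \<bar>c y - c x\<bar> * K"
        using K(1) by (cases "y = x") (simp_all add: add_divide_distrib)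
      finally show "norm (norm (c y * h y - c x * h x - c x * h' (y - x)) / norm (y - x))
          \<le> \<bar>c y\<bar> * (norm (h y - h x - h' (y - x)) / norm (y - x)) + \<bar>c y - c x\<bar> * K" by simp
    qed
  qed
qed

text \<open>Solving the equation at \<open>y\<close> with the inverse of the fixed form
  \<open>B x\<close> gives \<open>u y = u x + J (r y)\<close>. The residual \<open>r\<close> still
  contains \<open>u y\<close>, which is only known to be continuous, but multiplied by
  \<open>B y - B x\<close>, which vanishes at \<open>x\<close>; so
  \<open>has_derivative_mult_vanishing\<close> applies.\<close>

lemma differentiable_inner_form_solution:
  fixes B :: "'e::real_normed_vector \<Rightarrow> 'a::euclidean_space \<Rightarrow> 'a \<Rightarrow> real"
  assumes "open S" "x \<in> S"
    and B: "\<And>y. y \<in> S \<Longrightarrow> inner_form (B y)" and dB: "\<And>u w. (\<lambda>y. B y u w) differentiable (at x)"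
    and dl: "\<And>z. (\<lambda>y. l y z) differentiable (at x)"
    and u: "\<And>y z. y \<in> S \<Longrightarrow> B y (u y) z = l y z" and cu: "continuous_on S u"
  shows "u differentiable (at x)"
proof -
  have Bx: "inner_form (B x)" using assms(2) by (rule B)
  then have blx: "bilinear (B x)" by (simp add: inner_form_def)
  have cont: "isCont (\<lambda>y. u y \<bullet> b) x" for b
    using cu assms(1,2) continuous_on_eq_continuous_at by (intro continuous_intros) blast
  have "\<exists>J. \<forall>r z. B x (J r) z = r \<bullet> z"
    by (intro choice allI inner_form_representation[OF Bx] bounded_linear.linear bounded_linear_inner_right)
  then obtain J where J: "\<And>r z. B x (J r) z = r \<bullet> z" by blast
  have linJ: "linear J"
  proof (rule linearI)
    show "J (r + s) = J r + J s" for r s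
      by (intro inner_form_eqI[OF Bx]) (simp add: J bilinear_ladd[OF blx] inner_add_left)
    show "J (k *\<^sub>R r) = k *\<^sub>R J r" for k r
      by (intro inner_form_eqI[OF Bx]) (simp add: J bilinear_lmul[OF blx])
  qed
  \<comment> \<open>Its component along \<open>b\<close> is \<open>B x (u y - u x) b\<close>,
    rewritten with the equations at \<open>x\<close> and \<open>y\<close>.\<close>
  define r where "r y = (\<Sum>b\<in>Basis. (l y b - l x b - (\<Sum>b'\<in>Basis. (u y \<bullet> b') * (B y b' b - B x b' b))) *\<^sub>R b)" for y
  have 1: "(\<lambda>y. (u y \<bullet> b') * (B y b' b - B x b' b)) differentiable (at x)" for b b'
  proof -
    have "((\<lambda>y. B y b' b - B x b' b) has_derivative (\<lambda>v. dird v (\<lambda>y. B y b' b) x - 0)) (at x)"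
      by (rule has_derivative_diff[OF has_derivative_dird[OF dB] has_derivative_const])
    from has_derivative_mult_vanishing[OF cont this] show ?thesis
      unfolding differentiable_def by auto
  qed
  have "r differentiable (at x)"
    unfolding r_def[abs_def]
    by (rule differentiable_sum[OF finite_Basis], intro ballI differentiable_scaleR differentiable_const
        differentiable_diff[OF differentiable_diff[OF dl differentiable_const]]
        differentiable_sum[OF finite_Basis] 1)
  then have "(\<lambda>y. J (r y)) differentiable (at x)"
    using differentiable_compose[OF linear_imp_differentiable[OF linJ]] by blast
  then have "(\<lambda>y. u x + J (r y)) differentiable (at x)"
    by (rule differentiable_add[OF differentiable_const])
  moreover have "u x + J (r y) = u y" if y: "y \<in> S" for y
  proof (rule inner_form_eqI[OF Bx])
    have bl: "bilinear (B x)" "bilinear (B y)" using B assms(2) y by (auto simp: inner_form_def)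
    have lin: "linear (\<lambda>u. B y u z - B x u z)" for z
      using bl by (simp add: bilinear_def linear_compose_sub)
    fix z
    have "r y \<bullet> b = B x (u y) b - B x (u x) b" if "b \<in> Basis" for b
      using that linear_Basis_expand[OF lin, of "u y" b] u[OF y] u[OF assms(2)]
      by (simp add: r_def right_diff_distrib)
    then have "r y \<bullet> z = B x (u y - u x) z"
      using linear_Basis_expand[of "B x (u y - u x)" z] bl
      by (subst euclidean_inner) (simp add: bilinear_def bilinear_lsub[OF bl(1)] mult.commute)
    then show "B x (u x + J (r y)) z = B x (u y) z"
      by (simp add: bilinear_ladd[OF bl(1)] J bilinear_lsub[OF bl(1)])
  qed
  ultimately show ?thesis
    using differentiable_cong_open[OF assms(1,2), of "\<lambda>y. u x + J (r y)" u] by blast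
qed

text \<open>Bootstrapping: a derivative of \<open>u\<close> solves an equation with the same
  \<open>B\<close> and a new right side that involves \<open>u\<close> but none of its derivatives.
  Hence the induction generalises over \<open>l\<close> and \<open>u\<close>.\<close>

lemma C_on_inner_form_solution:
  fixes B :: "'e::real_normed_vector \<Rightarrow> 'a::euclidean_space \<Rightarrow> 'a \<Rightarrow> real"
  assumes S: "open S" and B: "\<And>y. y \<in> S \<Longrightarrow> inner_form (B y)" and l: "\<And>y. y \<in> S \<Longrightarrow> linear (l y)"
    and "\<And>u w. C_on k S (\<lambda>y. B y u w)" "\<And>z. C_on k S (\<lambda>y. l y z)"
    and "\<And>y z. y \<in> S \<Longrightarrow> B y (u y) z = l y z"
  shows "C_on k S u"
  using assms(3-)
proof (induction k arbitrary: u l)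
  case 0
  then show ?case
    using continuous_on_inner_form_solution[of S B l u, OF B] by (simp del: split_paired_All)
next
  case (Suc k)
  note dB = C_on_Suc_differentiable[OF Suc.prems(2)] and dl = C_on_Suc_differentiable[OF Suc.prems(3)]
  have bl: "\<And>y. y \<in> S \<Longrightarrow> bilinear (B y)" using B by (simp add: inner_form_def)
  have lin: "linear (\<lambda>u. B y u w)" if "y \<in> S" for y w
    using bl[OF that] by (simp add: bilinear_def)
  have Cu: "C_on k S u"
    by (rule Suc.IH[OF Suc.prems(1) C_on_SucD[OF Suc.prems(2)] C_on_SucD[OF Suc.prems(3)] Suc.prems(4)])
  have du: "u differentiable (at x)" if "x \<in> S" for x
    using differentiable_inner_form_solution[OF S that B dB[OF that] dl[OF that] Suc.prems(4) C_on_continuous_on[OF Cu]] .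
  have "C_on k S (dird v u)" for v
  proof -
    \<comment> \<open>In the second term \<open>u y\<close> is frozen, so only \<open>B\<close> is
      differentiated.\<close>
    define l' where "l' y z = dird v (\<lambda>y'. l y' z) y - dird v (\<lambda>y'. B y' (u y) z) y" for y z
    show ?thesis
    proof (rule Suc.IH[of l'])
      fix y assume y: "y \<in> S"
      have "linear (B y' (u y))" if "y' \<in> S" for y'
        using bl[OF that] by (simp add: bilinear_def)
      then have b: "linear (\<lambda>z. dird v (\<lambda>y'. B y' (u y) z) y)"
        by (intro linear_dird_family[OF S y, of "\<lambda>y'. B y' (u y)"] dB y)
      have a: "linear (\<lambda>z. dird v (\<lambda>y'. l y' z) y)"
        by (rule linear_dird_family[OF S y Suc.prems(1) dl[OF y]])
      show "linear (l' y)"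
        using linear_compose_sub[OF a b] by (simp add: l'_def[abs_def])
      fix z
      have "dird v (\<lambda>y'. B y' (u y') z) y = dird v (\<lambda>y'. l y' z) y"
        by (rule dird_cong[OF S y Suc.prems(4)])
      then show "B y (dird v u y) z = l' y z"
        using dird_eqI[OF has_derivative_linear_family[OF S y lin dB[OF y] du[OF y]], of v z]
        unfolding l'_def by simp
    next
      show "C_on k S (\<lambda>y. B y u w)" for u w by (rule C_on_SucD[OF Suc.prems(2)])
      show "C_on k S (\<lambda>y. l' y z)" for z
        unfolding l'_def
      proof (rule C_on_diff[OF S])
        show "C_on k S (\<lambda>y. dird v (\<lambda>y'. l y' z) y)"
          by (rule C_on_dird[OF Suc.prems(3)])
        show "C_on k S (\<lambda>y. dird v (\<lambda>y'. B y' (u y) z) y)"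
          by (rule C_on_linear_family[OF S linear_dird_family[OF S _ lin dB] C_on_dird[OF Suc.prems(2)] Cu])
      qed
    qed
  qed
  then show ?case using du by (simp add: C_on_Suc_dird)
qed

section \<open>Curvature in coordinates\<close>

text \<open>The right side is linear in \<open>z\<close>, so it is represented by exactly one vector
  and the description in \<open>christoffel\<close> is well defined.\<close>

lemma christoffel_koszul:
  fixes g :: "'e::euclidean_space \<Rightarrow> 'e \<Rightarrow> 'e \<Rightarrow> real"
  assumes S: "open S" "x \<in> S" and g: "\<And>y. y \<in> S \<Longrightarrow> inner_form (g y)"
    and dg: "\<And>u w. (\<lambda>y. g y u w) differentiable (at x)"
  shows "2 * g x (christoffel g x v w) z
    = dird v (\<lambda>y. g y w z) x + dird w (\<lambda>y. g y v z) x - dird z (\<lambda>y. g y v w) x"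
proof -
  let ?l = "\<lambda>z. dird v (\<lambda>y. g y w z) x + dird w (\<lambda>y. g y v z) x - dird z (\<lambda>y. g y v w) x"
  have gx: "inner_form (g x)" by (rule g[OF S(2)])
  have lin: "linear (g y u)" if "y \<in> S" for y u
    using g[OF that] by (simp add: inner_form_def bilinear_def)
  have l: "linear ?l"
    by (rule linear_compose_sub[OF linear_compose_add[OF linear_dird_family[OF S lin dg]
            linear_dird_family[OF S lin dg]] linear_dird[OF dg]])
  have "linear (\<lambda>z. (1/2) *\<^sub>R ?l z)"
    by (rule linear_compose_scale_right[OF l])
  from inner_form_representation[OF gx this]
  obtain u where u: "\<And>z. g x u z = (1/2) *\<^sub>R ?l z" by blast
  have "\<exists>!u. \<forall>z. 2 * g x u z = ?l z"
  proof (rule ex1I)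
    have "2 * g x u z = ?l z" for z using u[of z] by simp
    then show "\<forall>z. 2 * g x u z = ?l z" ..
    show "u' = u" if "\<forall>z. 2 * g x u' z = ?l z" for u'
    proof (rule inner_form_eqI[OF gx])
      show "g x u' z = g x u z" for z using spec[OF that, of z] u[of z] by simp
    qed
  qed
  from theI'[OF this] show ?thesis
    by (simp add: christoffel_def dird_def)
qed

text \<open>One order is lost because the Koszul formula contains first derivatives of the
  metric.\<close>

lemma C_on_christoffel:
  fixes g :: "'e::euclidean_space \<Rightarrow> 'e \<Rightarrow> 'e \<Rightarrow> real"
  assumes S: "open S" and g: "\<And>y. y \<in> S \<Longrightarrow> inner_form (g y)"
    and Cg: "\<And>u w. C_on (Suc k) S (\<lambda>y. g y u w)"
  shows "C_on k S (\<lambda>x. christoffel g x v w)"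
proof (rule C_on_inner_form_solution[OF S g])
  let ?l = "\<lambda>x z. (1/2) * (dird v (\<lambda>y. g y w z) x + dird w (\<lambda>y. g y v z) x - dird z (\<lambda>y. g y v w) x)"
  show eq: "g x (christoffel g x v w) z = ?l x z" if "x \<in> S" for x z
    using christoffel_koszul[OF S that g C_on_Suc_differentiable[OF Cg that], of v w z] by simp
  \<comment> \<open>Linearity is inherited from the left side of \<open>eq\<close>.\<close>
  show "linear (?l x)" if "x \<in> S" for x
    unfolding eq[OF that, symmetric] using g[OF that] by (simp add: inner_form_def bilinear_def)
  show "C_on k S (\<lambda>y. g y u w)" for u w by (rule C_on_SucD[OF Cg])
  show "C_on k S (\<lambda>x. ?l x z)" for z
    by (intro C_on_mult[OF S C_on_const] C_on_diff[OF S] C_on_add[OF S] C_on_dird Cg)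
qed

text \<open>Differentiating the Koszul formula, paired with the fixed vector \<open>v\<close>, eliminates the derivatives of
  the Christoffel symbols.\<close>

lemma curvature_tensor_coordinates:
  fixes g :: "'e::euclidean_space \<Rightarrow> 'e \<Rightarrow> 'e \<Rightarrow> real"
  assumes S: "open S" "x \<in> S" and g: "\<And>y. y \<in> S \<Longrightarrow> inner_form (g y)"
    and Cg: "\<And>u w. C_on 2 S (\<lambda>y. g y u w)"
  shows "2 * g x (curvature_tensor g x v w w) v =
      2 * dird v (dird w (\<lambda>y. g y v w)) x - dird v (dird v (\<lambda>y. g y w w)) x
    - dird w (dird w (\<lambda>y. g y v v)) x
    + 2 * g x (christoffel g x v w) (christoffel g x v w)
    - 2 * g x (christoffel g x v v) (christoffel g x w w)"
proof -
  have Cg1: "C_on (Suc (Suc 0)) S (\<lambda>y. g y u w)" for u w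
    using Cg by (simp add: numeral_2_eq_2)
  note dg = C_on_Suc_differentiable[OF Cg1]
  have ddg: "dird a (\<lambda>y. g y u w) differentiable (at x)" for a u w
    by (rule C_on_Suc_differentiable[OF C_on_dird[OF Cg1] S(2)])
  define \<Gamma> where "\<Gamma> a b y = christoffel g y a b" for a b y
  have \<Gamma>: "2 * g y (\<Gamma> a b y) z = dird a (\<lambda>y. g y b z) y + dird b (\<lambda>y. g y a z) y - dird z (\<lambda>y. g y a b) y"
    if "y \<in> S" for a b y z
    unfolding \<Gamma>_def by (rule christoffel_koszul[OF S(1) that g dg[OF that]])
  have d\<Gamma>: "\<Gamma> a b differentiable (at x)" for a b
    unfolding \<Gamma>_def[abs_def] by (rule C_on_Suc_differentiable[OF C_on_christoffel[OF S(1) g Cg1] S(2)])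
  have sym: "g y a b = g y b a" if "y \<in> S" for y a b
    using g[OF that] by (simp add: inner_form_def)
  have dsym: "dird c (\<lambda>y. g y a b) y = dird c (\<lambda>y. g y b a) y" if "y \<in> S" for a b c y
    by (rule dird_cong[OF S(1) that sym])
  have lin: "linear (\<lambda>u. g y u z)" if "y \<in> S" for y z
    using g[OF that] by (simp add: inner_form_def bilinear_def)
  have prod: "dird c (\<lambda>y. g y (\<Gamma> a b y) z) x
      = dird c (\<lambda>y. g y (\<Gamma> a b x) z) x + g x (dird c (\<Gamma> a b) x) z" for a b c z
    by (rule dird_eqI[OF has_derivative_linear_family[OF S lin dg[OF S(2)] d\<Gamma>]])
  have R: "curvature_tensor g x v w w = dird v (\<Gamma> w w) x + \<Gamma> v (\<Gamma> w w x) x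
      - (dird w (\<Gamma> v w) x + \<Gamma> w (\<Gamma> v w x) x)"
    by (simp add: curvature_tensor_def cov_deriv_def[abs_def] \<Gamma>_def[abs_def] dird_def)
  have "dird v (\<lambda>y. g y (\<Gamma> w w y) v) x
      = dird v (\<lambda>y. dird w (\<lambda>y. g y v w) y - (1/2) * dird v (\<lambda>y. g y w w) y) x"
  proof (rule dird_cong[OF S])
    show "g y (\<Gamma> w w y) v = dird w (\<lambda>y. g y v w) y - (1/2) * dird v (\<lambda>y. g y w w) y" if "y \<in> S" for y
      using \<Gamma>[OF that, of w w v] dsym[OF that, of w w v] by simp
  qed
  also have "\<dots> = dird v (dird w (\<lambda>y. g y v w)) x - (1/2) * dird v (dird v (\<lambda>y. g y w w)) x"
    by (simp only: dird_diff[OF ddg differentiable_mult[OF differentiable_const ddg]] dird_cmult[OF ddg])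
  finally have 1: "2 * g x (dird v (\<Gamma> w w) x) v
      = 2 * dird v (dird w (\<lambda>y. g y v w)) x - dird v (dird v (\<lambda>y. g y w w)) x - 2 * dird v (\<lambda>y. g y (\<Gamma> w w x) v) x"
    unfolding prod by simp
  have "dird w (\<lambda>y. g y (\<Gamma> v w y) v) x = dird w (\<lambda>y. (1/2) * dird w (\<lambda>y. g y v v) y) x"
  proof (rule dird_cong[OF S])
    show "g y (\<Gamma> v w y) v = (1/2) * dird w (\<lambda>y. g y v v) y" if "y \<in> S" for y
      using \<Gamma>[OF that, of v w v] dsym[OF that, of v w v] by simp
  qed
  also have "\<dots> = (1/2) * dird w (dird w (\<lambda>y. g y v v)) x"
    by (rule dird_cmult[OF ddg])
  finally have 2: "2 * g x (dird w (\<Gamma> v w) x) v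
      = dird w (dird w (\<lambda>y. g y v v)) x - 2 * dird w (\<lambda>y. g y (\<Gamma> v w x) v) x"
    unfolding prod by simp
  have split: "g x (curvature_tensor g x v w w) v = g x (dird v (\<Gamma> w w) x) v + g x (\<Gamma> v (\<Gamma> w w x) x) v
      - (g x (dird w (\<Gamma> v w) x) v + g x (\<Gamma> w (\<Gamma> v w x) x) v)"
  proof -
    have "bilinear (g x)" using g[OF S(2)] by (simp add: inner_form_def)
    then show ?thesis unfolding R by (simp add: bilinear_ladd bilinear_lsub)
  qed
  \<comment> \<open>The remaining first derivatives of the metric are absorbed by Koszul formulas
    with a Christoffel vector as one argument; they become the two products of Christoffel
    symbols.\<close>
  show ?thesis
    using 1 2 split \<Gamma>[OF S(2), of v "\<Gamma> w w x" v] \<Gamma>[OF S(2), of w "\<Gamma> v w x" v]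
      \<Gamma>[OF S(2), of v v "\<Gamma> w w x"] \<Gamma>[OF S(2), of v w "\<Gamma> v w x"]
      dsym[OF S(2), of _ "\<Gamma> w w x" v] dsym[OF S(2), of _ "\<Gamma> v w x" v] dsym[OF S(2), of _ "\<Gamma> v w x" w]
      dsym[OF S(2), of "\<Gamma> v w x" w v]
    unfolding \<Gamma>_def[of v v x, symmetric] \<Gamma>_def[of w w x, symmetric] \<Gamma>_def[of v w x, symmetric]
    by simp
qed

text \<open>If the form is not zero on \<open>T\<close>, a hyperbolic pair \<open>e\<close>,
  \<open>f\<close> splits off. Its complement \<open>T'\<close> has dimension smaller by 2, hence
  odd again, and a kernel vector of \<open>T'\<close> is orthogonal to \<open>e\<close> and
  \<open>f\<close> by the choice of \<open>T'\<close>.\<close>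

lemma skew_form_kernel:
  fixes \<omega> :: "'a::euclidean_space \<Rightarrow> 'a \<Rightarrow> real"
  assumes bl: "bilinear \<omega>" and skew: "\<And>u w. \<omega> u w = - \<omega> w u"
    and "subspace T" "odd (dim T)"
  shows "\<exists>t\<in>T. t \<noteq> 0 \<and> (\<forall>s\<in>T. \<omega> t s = 0)"
  using assms(3,4)
proof (induction "dim T" arbitrary: T rule: less_induct)
  case less
  note simps = bilinear_ladd[OF bl] bilinear_lsub[OF bl] bilinear_lmul[OF bl]
    bilinear_radd[OF bl] bilinear_rsub[OF bl] bilinear_rmul[OF bl] bilinear_lzero[OF bl] bilinear_rzero[OF bl]
  have self: "\<omega> u u = 0" for u using skew[of u u] by simp
  show ?case
  proof (cases "\<forall>t\<in>T. \<forall>s\<in>T. \<omega> t s = 0")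
    case True
    have "\<not> T \<subseteq> {0}" using less.prems(2) by (metis dim_eq_0 even_zero)
    then show ?thesis using True by blast
  next
    case False
    then obtain e f0 where ef: "e \<in> T" "f0 \<in> T" "\<omega> e f0 \<noteq> 0" by blast
    define f where "f = (1 / \<omega> e f0) *\<^sub>R f0"
    have f: "f \<in> T" "\<omega> e f = 1" "\<omega> f e = -1"
      using ef less.prems(1) skew[of f e] by (simp_all add: f_def subspace_scale simps)
    define T' where "T' = {t \<in> T. \<omega> t e = 0 \<and> \<omega> t f = 0}"
    have T': "subspace T'"
      using less.prems(1) by (auto simp: T'_def subspace_def simps)
    have ne: "e \<noteq> f" using f self[of e] by auto
    have ind: "independent {e, f}"
    proof (rule independent_if_scalars_zero)
      fix c x assume *: "(\<Sum>x\<in>{e, f}. c x *\<^sub>R x) = 0" and x: "x \<in> {e, f}"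
      from * ne have z: "c e *\<^sub>R e + c f *\<^sub>R f = 0" by simp
      have "c f = \<omega> e (c e *\<^sub>R e + c f *\<^sub>R f)" "- c e = \<omega> f (c e *\<^sub>R e + c f *\<^sub>R f)"
        using f self by (simp_all add: simps)
      then show "c x = 0" using x unfolding z by (auto simp: simps)
    qed simp
    have sum: "{x + y |x y. x \<in> span {e, f} \<and> y \<in> T'} = T"
    proof (intro equalityI subsetI)
      fix t assume "t \<in> {x + y |x y. x \<in> span {e, f} \<and> y \<in> T'}"
      moreover have "span {e, f} \<subseteq> T" using ef f less.prems(1) by (simp add: span_minimal)
      ultimately show "t \<in> T" using less.prems(1) by (auto simp: T'_def subspace_add)
    next
      fix t assume t: "t \<in> T"
      \<comment> \<open>The projection of \<open>t\<close> to \<open>span {e, f}\<close> along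
        \<open>T'\<close>, read off from \<open>\<omega> e f = 1\<close>.\<close>
      let ?p = "\<omega> t f *\<^sub>R e - \<omega> t e *\<^sub>R f"
      have "?p \<in> span {e, f}" by (intro span_diff span_scale span_base) auto
      moreover have "t - ?p \<in> T'"
        using t ef f less.prems(1) self
        by (auto simp: T'_def simps intro!: subspace_diff subspace_scale)
      ultimately show "t \<in> {x + y |x y. x \<in> span {e, f} \<and> y \<in> T'}"
        by (intro CollectI exI[of _ ?p] exI[of _ "t - ?p"]) simp
    qed
    have int: "span {e, f} \<inter> T' = {0}"
    proof -
      have "t = 0" if t: "t \<in> span {e, f}" "t \<in> T'" for t
      proof -
        from t(1) obtain a b where ab: "t = a *\<^sub>R e + b *\<^sub>R f"
          by (auto simp: span_insert span_singleton algebra_simps)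
        have "\<omega> t f = a" "\<omega> t e = - b" using f self by (simp_all add: ab simps)
        then show "t = 0" using t(2) ab by (simp add: T'_def)
      qed
      then show ?thesis using span_zero subspace_0[OF T'] by blast
    qed
    have "dim T + 0 = 2 + dim T'"
      using dim_sums_Int[OF subspace_span[of "{e, f}"] T'] ind ne
      unfolding sum int by (simp add: dim_eq_card_independent)
    then have d: "dim T' < dim T" "odd (dim T')" using less.prems(2) by auto
    obtain t where t: "t \<in> T'" "t \<noteq> 0" "\<And>s. s \<in> T' \<Longrightarrow> \<omega> t s = 0"
      using less.hyps[OF d(1) T' d(2)] by blast
    have "\<omega> t s = 0" if s: "s \<in> T" for s
    proof -
      obtain x y where xy: "s = x + y" "x \<in> span {e, f}" "y \<in> T'" using s sum by blast
      from xy(2) obtain a b where "x = a *\<^sub>R e + b *\<^sub>R f"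
        by (auto simp: span_insert span_singleton algebra_simps)
      then show ?thesis using t xy by (simp add: T'_def simps)
    qed
    then show ?thesis using t by (auto simp: T'_def)
  qed
qed

section \<open>Curvature of a warped metric at a critical point\<close>

text \<open>Both mixed terms of the Leibniz rule carry a first derivative of
  \<open>f\<close>.\<close>

lemma dird_dird_mult_critical:
  fixes f q :: "'e::real_normed_vector \<Rightarrow> real"
  assumes S: "open S" "x \<in> S" and f: "C_on 2 S f" and q: "C_on 2 S q" and crit: "\<And>u. dird u f x = 0"
  shows "dird u (dird w (\<lambda>y. f y * q y)) x = f x * dird u (dird w q) x + q x * dird u (dird w f) x"
proof -
  have f': "C_on (Suc (Suc 0)) S f" and q': "C_on (Suc (Suc 0)) S q"
    using f q by (simp_all add: numeral_2_eq_2)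
  note df = C_on_Suc_differentiable[OF f'] and dq = C_on_Suc_differentiable[OF q']
    and ddf = C_on_Suc_differentiable[OF C_on_dird[OF f'] S(2)]
    and ddq = C_on_Suc_differentiable[OF C_on_dird[OF q'] S(2)]
  have "dird u (dird w (\<lambda>y. f y * q y)) x = dird u (\<lambda>y. f y * dird w q y + dird w f y * q y) x"
    by (rule dird_cong[OF S]) (rule dird_mult[OF df dq])
  also have "\<dots> = dird u (\<lambda>y. f y * dird w q y) x + dird u (\<lambda>y. dird w f y * q y) x"
    by (rule dird_add[OF differentiable_mult[OF df[OF S(2)] ddq] differentiable_mult[OF ddf dq[OF S(2)]]])
  also have "\<dots> = f x * dird u (dird w q) x + q x * dird u (dird w f) x"
    by (simp add: dird_mult[OF df[OF S(2)] ddq] dird_mult[OF ddf dq[OF S(2)]] crit)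
  finally show ?thesis .
qed

text \<open>A foliated chart \<open>S\<close> with a warped metric \<open>g\<close>, near a critical point \<open>x\<close> of the warping function.
  \<open>\<kappa>\<close> is the metric along the leaves, \<open>p\<close> the vertical projection (which plays the role of a
  connection form) and \<open>h\<close> the pulled back metric of the leaf space.  The axiom \<open>geodesic\<close> is the
  vanishing of the second fundamental form of the leaves for the unwarped metric, written out with
  the Koszul formula.\<close>

locale warped_chart =
  fixes S :: "('v::euclidean_space \<times> 'h::euclidean_space) set"
    and x :: "'v \<times> 'h"
    and \<kappa> :: "'v \<times> 'h \<Rightarrow> 'v \<Rightarrow> 'v \<Rightarrow> real"
    and p :: "'v \<times> 'h \<Rightarrow> 'v \<times> 'h \<Rightarrow> 'v"
    and h g :: "'v \<times> 'h \<Rightarrow> 'v \<times> 'h \<Rightarrow> 'v \<times> 'h \<Rightarrow> real"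
    and f :: "'v \<times> 'h \<Rightarrow> real"
  assumes S: "open S" "x \<in> S"
    and \<kappa>: "\<And>y. y \<in> S \<Longrightarrow> inner_form (\<kappa> y)" and C\<kappa>: "\<And>a b. C_on 2 S (\<lambda>y. \<kappa> y a b)"
    and p: "\<And>y. y \<in> S \<Longrightarrow> linear (p y)" and Cp: "\<And>u. C_on 2 S (\<lambda>y. p y u)"
    and p_vertical: "\<And>y a. y \<in> S \<Longrightarrow> p y (a, 0) = a"
    and Ch: "\<And>u w. C_on 2 S (\<lambda>y. h y u w)"
    and h_vertical: "\<And>y a w. y \<in> S \<Longrightarrow> h y (a, 0) w = 0" "\<And>y a w. y \<in> S \<Longrightarrow> h y w (a, 0) = 0"
    and h_basic: "\<And>y a u w. y \<in> S \<Longrightarrow> dird (a, 0) (\<lambda>y. h y u w) y = 0"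
    and Cf: "C_on 2 S f" and f_pos: "f x > 0"
    and critical: "\<And>u. dird u f x = 0"
    and g: "\<And>y. y \<in> S \<Longrightarrow> inner_form (g y)"
    and g_eq: "\<And>y u w. y \<in> S \<Longrightarrow> g y u w = f y * \<kappa> y (p y u) (p y w) + h y u w"
    and geodesic: "\<And>y z a b. y \<in> S \<Longrightarrow> p y z = 0 \<Longrightarrow> dird z (\<lambda>y. \<kappa> y a b) y
      = \<kappa> y b (dird (a, 0) (\<lambda>y. p y z) y) + \<kappa> y a (dird (b, 0) (\<lambda>y. p y z) y)"
begin

section \<open>Regularity and first derivatives of the data in the chart\<close>

lemma \<kappa>_bilinear: "y \<in> S \<Longrightarrow> bilinear (\<kappa> y)"
  using \<kappa> by (simp add: inner_form_def)

lemma \<kappa>_sym: "y \<in> S \<Longrightarrow> \<kappa> y a b = \<kappa> y b a"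
  using \<kappa> by (simp add: inner_form_def)

lemmas \<kappa>_simps = bilinear_ladd[OF \<kappa>_bilinear[OF S(2)]] bilinear_lsub[OF \<kappa>_bilinear[OF S(2)]]
  bilinear_radd[OF \<kappa>_bilinear[OF S(2)]] bilinear_rsub[OF \<kappa>_bilinear[OF S(2)]]
  bilinear_lzero[OF \<kappa>_bilinear[OF S(2)]] bilinear_rzero[OF \<kappa>_bilinear[OF S(2)]]
  bilinear_lmul[OF \<kappa>_bilinear[OF S(2)]] bilinear_rmul[OF \<kappa>_bilinear[OF S(2)]]

lemma C\<kappa>': "C_on (Suc (Suc 0)) S (\<lambda>y. \<kappa> y a b)" using C\<kappa> by (simp add: numeral_2_eq_2)
lemma Cp': "C_on (Suc (Suc 0)) S (\<lambda>y. p y u)" using Cp by (simp add: numeral_2_eq_2)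
lemma Cf': "C_on (Suc (Suc 0)) S f" using Cf by (simp add: numeral_2_eq_2)
lemma Ch': "C_on (Suc (Suc 0)) S (\<lambda>y. h y u w)" using Ch by (simp add: numeral_2_eq_2)

lemmas d\<kappa> = C_on_Suc_differentiable[OF C\<kappa>']
  and dp = C_on_Suc_differentiable[OF Cp']
  and df = C_on_Suc_differentiable[OF Cf']
  and dh = C_on_Suc_differentiable[OF Ch']
  and dd\<kappa> = C_on_Suc_differentiable[OF C_on_dird[OF C\<kappa>']]
  and ddp = C_on_Suc_differentiable[OF C_on_dird[OF Cp']]

lemma Cg: "C_on 2 S (\<lambda>y. g y u w)"
proof (rule C_on_congI[OF _ S(1)])
  show "C_on 2 S (\<lambda>y. f y * \<kappa> y (p y u) (p y w) + h y u w)"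
    by (rule C_on_add[OF S(1) C_on_mult[OF S(1) Cf
        C_on_bilinear_family[OF S(1) \<kappa>_bilinear C\<kappa> Cp Cp]] Ch])
qed (rule g_eq)

lemma dird_p_vertical: "y \<in> S \<Longrightarrow> dird c (\<lambda>y. p y (a, 0)) y = 0"
  using dird_cong[OF S(1), of y "\<lambda>y. p y (a, 0)" "\<lambda>_. a" c] p_vertical by simp

lemma dird_\<kappa>_zero: "y \<in> S \<Longrightarrow> dird c (\<lambda>y. \<kappa> y 0 b) y = 0" "y \<in> S \<Longrightarrow> dird c (\<lambda>y. \<kappa> y b 0) y = 0"
  using dird_cong[OF S(1), of y "\<lambda>y. \<kappa> y 0 b" "\<lambda>_. 0" c] dird_cong[OF S(1), of y "\<lambda>y. \<kappa> y b 0" "\<lambda>_. 0" c]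
  by (simp_all add: bilinear_lzero bilinear_rzero \<kappa>_bilinear)

lemma dird_h_vertical: "y \<in> S \<Longrightarrow> dird c (\<lambda>y. h y (a, 0) w) y = 0" "y \<in> S \<Longrightarrow> dird c (\<lambda>y. h y w (a, 0)) y = 0"
  using dird_cong[OF S(1), of y "\<lambda>y. h y (a, 0) w" "\<lambda>_. 0" c] dird_cong[OF S(1), of y "\<lambda>y. h y w (a, 0)" "\<lambda>_. 0" c]
  by (simp_all add: h_vertical)

lemma dird_\<kappa>_family:
  assumes "y \<in> S" "U differentiable (at y)" "W differentiable (at y)"
  shows "dird c (\<lambda>y. \<kappa> y (U y) (W y)) y
    = dird c (\<lambda>z. \<kappa> z (U y) (W y)) y + \<kappa> y (dird c U y) (W y) + \<kappa> y (U y) (dird c W y)"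
  by (rule dird_bilinear_family[OF S(1) assms(1) \<kappa>_bilinear d\<kappa>[OF assms(1)] assms(2,3)])

lemma differentiable_\<kappa>_family:
  assumes "y \<in> S" "U differentiable (at y)" "W differentiable (at y)"
  shows "(\<lambda>y. \<kappa> y (U y) (W y)) differentiable (at y)"
  using has_derivative_bilinear_family[OF S(1) assms(1) \<kappa>_bilinear d\<kappa>[OF assms(1)] assms(2,3)]
  unfolding differentiable_def by blast

text \<open>To first order at the critical point \<open>f\<close> behaves like a constant, so no
  derivative of \<open>f\<close> occurs.\<close>

lemma dird_g:
  "dird c (\<lambda>y. g y u w) x = f x * (dird c (\<lambda>y. \<kappa> y (p x u) (p x w)) x
     + \<kappa> x (dird c (\<lambda>y. p y u) x) (p x w) + \<kappa> x (p x u) (dird c (\<lambda>y. p y w) x))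
   + dird c (\<lambda>y. h y u w) x"
proof -
  have d: "(\<lambda>y. \<kappa> y (p y u) (p y w)) differentiable (at x)"
    by (rule differentiable_\<kappa>_family[OF S(2) dp[OF S(2)] dp[OF S(2)]])
  have "dird c (\<lambda>y. g y u w) x = dird c (\<lambda>y. f y * \<kappa> y (p y u) (p y w) + h y u w) x"
    by (rule dird_cong[OF S]) (rule g_eq)
  also have "\<dots> = dird c (\<lambda>y. f y * \<kappa> y (p y u) (p y w)) x + dird c (\<lambda>y. h y u w) x"
    by (rule dird_add[OF differentiable_mult[OF df[OF S(2)] d] dh[OF S(2)]])
  finally show ?thesis
    unfolding dird_mult[OF df[OF S(2)] d] critical
      dird_\<kappa>_family[OF S(2) dp[OF S(2)] dp[OF S(2)]]
    by simp
qed

lemma linear_dird_\<kappa>: "y \<in> S \<Longrightarrow> linear (\<lambda>c. dird (c, 0) (\<lambda>z. \<kappa> z a b) y)"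
  using linear_compose[of "\<lambda>c. (c, 0)" "\<lambda>u. dird u (\<lambda>z. \<kappa> z a b) y"] linear_dird[OF d\<kappa>]
  by (simp add: linear_iff o_def)

lemma bilinear_dird_\<kappa>: "y \<in> S \<Longrightarrow> bilinear (\<lambda>a b. dird c (\<lambda>z. \<kappa> z a b) y)"
  unfolding bilinear_def
  by (intro conjI allI linear_dird_family[OF S(1)] d\<kappa>) (simp_all add: \<kappa>_bilinear[unfolded bilinear_def])

lemma differentiable_dird_\<kappa>:
  assumes "U differentiable (at x)" "W differentiable (at x)"
  shows "(\<lambda>y. dird c (\<lambda>z. \<kappa> z (U y) (W y)) y) differentiable (at x)"
  using has_derivative_bilinear_family[OF S bilinear_dird_\<kappa> dd\<kappa>[OF S(2)] assms]
  unfolding differentiable_def by blast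

lemma dird_dird_\<kappa>:
  assumes "U differentiable (at x)" "W differentiable (at x)"
  shows "dird u (\<lambda>y. dird c (\<lambda>z. \<kappa> z (U y) (W y)) y) x = dird u (\<lambda>y. dird c (\<lambda>z. \<kappa> z (U x) (W x)) y) x
    + dird c (\<lambda>z. \<kappa> z (dird u U x) (W x)) x + dird c (\<lambda>z. \<kappa> z (U x) (dird u W x)) x"
  by (rule dird_bilinear_family[OF S bilinear_dird_\<kappa> dd\<kappa>[OF S(2)] assms])

lemma dird_dird_\<kappa>_zero: "dird u (\<lambda>y. dird c (\<lambda>z. \<kappa> z b 0) y) x = 0"
  using dird_cong[OF S, of "\<lambda>y. dird c (\<lambda>z. \<kappa> z b 0) y" "\<lambda>_. 0" u] by (simp add: dird_\<kappa>_zero)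

lemma p_horizontal_part: "p x (z - (p x z, 0)) = 0"
  using linear_diff[OF p[OF S(2)]] p_vertical[OF S(2)] by simp

text \<open>The subtracted vertical vector is constant, and \<open>p\<close> maps it to the same
  value at every point of \<open>S\<close>.\<close>

lemma dird_p_horizontal_part: "dird c (\<lambda>y. p y (z - (p x z, 0))) x = dird c (\<lambda>y. p y z) x"
  using linear_diff[OF linear_dird_family[OF S p dp[OF S(2)]], of c z "(p x z, 0)"]
    dird_p_vertical[OF S(2)] by simp

lemma christoffel_g:
  "2 * g x (christoffel g x u w) z
    = dird u (\<lambda>y. g y w z) x + dird w (\<lambda>y. g y u z) x - dird z (\<lambda>y. g y u w) x"
  by (rule christoffel_koszul[OF S g C_on_Suc_differentiable[OF _ S(2)]])
    (use Cg in \<open>simp_all add: numeral_2_eq_2\<close>)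

text \<open>\<open>kernel\<close> says that \<open>dp(v, z)\<close>, the curvature of the connection
  form \<open>p\<close>, is \<open>\<kappa> x\<close>-orthogonal to \<open>a\<close> for all
  horizontal \<open>z\<close>.\<close>

context
  fixes v :: "'v \<times> 'h" and a :: 'v
  assumes v: "p x v = 0"
    and kernel: "\<And>z. p x z = 0 \<Longrightarrow> \<kappa> x a (dird v (\<lambda>y. p y z) x) = \<kappa> x a (dird z (\<lambda>y. p y v) x)"
begin

text \<open>The kernel condition removes O'Neill's integrability tensor, which is the horizontal part of
  \<open>\<nabla>\<^sub>v (a,0)\<close>.\<close>

lemma christoffel_mixed:
  "g x (christoffel g x v (a, 0)) z = f x * \<kappa> x (dird (a, 0) (\<lambda>y. p y v) x) (p x z)"
proof -
  define b where "b = p x z"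
  define zh where "zh = z - (b, 0)"
  have zh: "p x zh = 0" "z = zh + (b, 0)"
    unfolding zh_def b_def by (simp_all add: p_horizontal_part)
  \<comment> \<open>\<open>kernel\<close> speaks of horizontal vectors only, so the vertical part
    \<open>b\<close> of \<open>z\<close> leaves a correction term.\<close>
  have "dird z (\<lambda>y. p y v) x = dird zh (\<lambda>y. p y v) x + dird (b, 0) (\<lambda>y. p y v) x"
    using linear_add[OF linear_dird[OF dp[OF S(2)]]] zh(2) by simp
  moreover have "dird v (\<lambda>y. p y zh) x = dird v (\<lambda>y. p y z) x"
    unfolding zh_def b_def by (rule dird_p_horizontal_part)
  ultimately have "\<kappa> x a (dird v (\<lambda>y. p y z) x) = \<kappa> x a (dird z (\<lambda>y. p y v) x) - \<kappa> x a (dird (b, 0) (\<lambda>y. p y v) x)"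
    using kernel[OF zh(1)] by (simp add: \<kappa>_simps)
  then have "f x * \<kappa> x a (dird v (\<lambda>y. p y z) x) = f x * \<kappa> x a (dird z (\<lambda>y. p y v) x) - f x * \<kappa> x a (dird (b, 0) (\<lambda>y. p y v) x)"
    by (simp add: right_diff_distrib)
  \<comment> \<open>The derivative along \<open>(b, 0)\<close> in \<open>geodesic\<close> cancels
    the correction term.\<close>
  then have "2 * g x (christoffel g x v (a, 0)) z = 2 * (f x * \<kappa> x (dird (a, 0) (\<lambda>y. p y v) x) b)"
    unfolding christoffel_g dird_g b_def[symmetric] geodesic[OF S(2) v]
    using geodesic[OF S(2) v, of a b] \<kappa>_sym[OF S(2), of b]  \<kappa>_sym[OF S(2), of a]
    by (simp add: v p_vertical[OF S(2)] dird_p_vertical[OF S(2)] dird_\<kappa>_zero[OF S(2)] dird_h_vertical[OF S(2)]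
        h_basic[OF S(2)] \<kappa>_simps algebra_simps b_def[symmetric])
  then show ?thesis by (simp add: b_def)
qed

text \<open>\<open>christoffel_mixed\<close> is used twice: tested on \<open>(?b, 0)\<close> it
  gives the pairing of \<open>p x ?U\<close> with \<open>?b\<close>, tested on \<open>?U\<close> it
  gives the norm.\<close>

lemma christoffel_mixed_norm:
  "g x (christoffel g x v (a, 0)) (christoffel g x v (a, 0))
    = f x * \<kappa> x (dird (a, 0) (\<lambda>y. p y v) x) (dird (a, 0) (\<lambda>y. p y v) x)"
proof -
  let ?U = "christoffel g x v (a, 0)" and ?b = "dird (a, 0) (\<lambda>y. p y v) x"
  have "g x ?U (?b, 0) = f x * \<kappa> x (p x ?U) ?b"
    by (simp add: g_eq[OF S(2)] h_vertical[OF S(2)] p_vertical[OF S(2)])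
  then have "\<kappa> x (p x ?U) ?b = \<kappa> x ?b ?b"
    unfolding christoffel_mixed p_vertical[OF S(2)] using f_pos by simp
  then show ?thesis
    using christoffel_mixed[of ?U] \<kappa>_sym[OF S(2), of "p x ?U" ?b] by simp
qed

text \<open>Only \<open>p x z\<close> enters: the horizontal part of \<open>z\<close> contributes
  nothing by \<open>geodesic\<close>, since warping at a critical point leaves the leaf totally
  geodesic there.\<close>

lemma christoffel_vertical:
  "2 * g x (christoffel g x (a, 0) (a, 0)) z
    = f x * (2 * dird (a, 0) (\<lambda>y. \<kappa> y a (p x z)) x - dird (p x z, 0) (\<lambda>y. \<kappa> y a a) x)"
proof -
  define b where "b = p x z"
  define zh where "zh = z - (b, 0)"
  have zh: "p x zh = 0" "z = zh + (b, 0)"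
    unfolding zh_def b_def by (simp_all add: p_horizontal_part)
  have 1: "dird z (\<lambda>y. \<kappa> y a a) x = dird zh (\<lambda>y. \<kappa> y a a) x + dird (b, 0) (\<lambda>y. \<kappa> y a a) x"
    using linear_add[OF linear_dird[OF d\<kappa>[OF S(2)]]] zh(2) by simp
  have 2: "dird (a, 0) (\<lambda>y. p y zh) x = dird (a, 0) (\<lambda>y. p y z) x"
    unfolding zh_def b_def by (rule dird_p_horizontal_part)
  show ?thesis
    unfolding christoffel_g dird_g b_def[symmetric]
    by (simp add: 1 geodesic[OF S(2) zh(1)] 2 p_vertical[OF S(2)] dird_p_vertical[OF S(2)]
        dird_h_vertical[OF S(2)] h_basic[OF S(2)] \<kappa>_simps algebra_simps b_def[symmetric])
qed

text \<open>The vertical component suffices, because \<open>christoffel_vertical\<close> sees its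
  argument only through \<open>p x\<close>.\<close>

lemma christoffel_horizontal: "p x (christoffel g x v v) = dird v (\<lambda>y. p y v) x"
proof (rule inner_form_eqI[OF \<kappa>[OF S(2)]])
  let ?U = "christoffel g x v v"
  fix b
  have "g x ?U (b, 0) = f x * \<kappa> x (p x ?U) b"
    by (simp add: g_eq[OF S(2)] h_vertical[OF S(2)] p_vertical[OF S(2)])
  moreover have "2 * g x ?U (b, 0) = 2 * f x * \<kappa> x (dird v (\<lambda>y. p y v) x) b"
    unfolding christoffel_g dird_g
    by (simp add: v p_vertical[OF S(2)] dird_p_vertical[OF S(2)] dird_\<kappa>_zero[OF S(2)]
        dird_h_vertical[OF S(2)] h_basic[OF S(2)] \<kappa>_simps)
  ultimately show "\<kappa> x (p x ?U) b = \<kappa> x (dird v (\<lambda>y. p y v) x) b"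
    using f_pos by simp
qed

text \<open>\<open>h\<close> is constant along the leaves. The rest is quadratic in
  \<open>p y v\<close>, which vanishes at \<open>x\<close>, so only the product of two first
  derivatives survives.\<close>

lemma second_dird_vertical: "dird (a, 0) (dird (a, 0) (\<lambda>y. g y v v)) x
    = 2 * f x * \<kappa> x (dird (a, 0) (\<lambda>y. p y v) x) (dird (a, 0) (\<lambda>y. p y v) x)"
proof -
  let ?w = "(a, 0)" and ?s = "\<lambda>y. p y v"
  let ?q = "\<lambda>y. \<kappa> y (?s y) (?s y)"
  have Cq: "C_on 2 S ?q" by (rule C_on_bilinear_family[OF S(1) \<kappa>_bilinear C\<kappa> Cp Cp])
  have dq: "?q differentiable (at y)" if "y \<in> S" for y
    by (rule differentiable_\<kappa>_family[OF that dp[OF that] dp[OF that]])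
  have g_dird: "dird ?w (\<lambda>y. g y v v) y = dird ?w (\<lambda>y. f y * ?q y) y" if y: "y \<in> S" for y
  proof -
    have "dird ?w (\<lambda>y. g y v v) y = dird ?w (\<lambda>y. f y * ?q y + h y v v) y"
      by (rule dird_cong[OF S(1) y]) (rule g_eq)
    also have "\<dots> = dird ?w (\<lambda>y. f y * ?q y) y + dird ?w (\<lambda>y. h y v v) y"
      by (rule dird_add[OF differentiable_mult[OF df[OF y] dq[OF y]] dh[OF y]])
    finally show ?thesis by (simp add: h_basic[OF y])
  qed
  have "dird ?w (dird ?w (\<lambda>y. g y v v)) x = dird ?w (dird ?w (\<lambda>y. f y * ?q y)) x"
    by (rule dird_cong[OF S g_dird])
  also have "\<dots> = f x * dird ?w (dird ?w ?q) x"
    by (subst dird_dird_mult_critical[OF S Cf Cq critical]) (simp add: v \<kappa>_simps)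
  also have "dird ?w (dird ?w ?q) x = dird ?w (\<lambda>y. dird ?w (\<lambda>z. \<kappa> z (?s y) (?s y)) y + 2 * \<kappa> y (dird ?w ?s y) (?s y)) x"
  proof (rule dird_cong[OF S])
    fix y assume y: "y \<in> S"
    show "dird ?w ?q y = dird ?w (\<lambda>z. \<kappa> z (?s y) (?s y)) y + 2 * \<kappa> y (dird ?w ?s y) (?s y)"
      by (subst dird_\<kappa>_family[OF y dp[OF y] dp[OF y]]) (simp add: \<kappa>_sym[OF y, of "dird ?w ?s y"])
  qed
  also have "\<dots> = dird ?w (\<lambda>y. dird ?w (\<lambda>z. \<kappa> z (?s y) (?s y)) y) x + dird ?w (\<lambda>y. 2 * \<kappa> y (dird ?w ?s y) (?s y)) x"
    by (rule dird_add[OF differentiable_dird_\<kappa>[OF dp[OF S(2)] dp[OF S(2)]]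
      differentiable_mult[OF differentiable_const differentiable_\<kappa>_family[OF S(2) ddp[OF S(2)] dp[OF S(2)]]]])
  also have "\<dots> = 2 * \<kappa> x (dird ?w ?s x) (dird ?w ?s x)"
    unfolding dird_dird_\<kappa>[OF dp[OF S(2)] dp[OF S(2)]]
      dird_cmult[OF differentiable_\<kappa>_family[OF S(2) ddp[OF S(2)] dp[OF S(2)]]]
      dird_\<kappa>_family[OF S(2) ddp[OF S(2)] dp[OF S(2)]]
    by (simp add: v \<kappa>_simps dird_\<kappa>_zero[OF S(2)] dird_dird_\<kappa>_zero)
  finally show ?thesis by simp
qed

text \<open>The coefficient is \<open>f y * \<kappa> y a (p y v)\<close>, which vanishes at
  \<open>x\<close>; therefore the Hessian of \<open>f\<close> is absent here.\<close>

lemma second_dird_mixed: "dird v (dird (a, 0) (\<lambda>y. g y v (a, 0))) x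
    = f x * (dird (a, 0) (\<lambda>y. \<kappa> y a (dird v (\<lambda>y. p y v) x)) x
      + dird v (\<lambda>y. \<kappa> y a (dird (a, 0) (\<lambda>y. p y v) y)) x)"
proof -
  let ?w = "(a, 0)" and ?s = "\<lambda>y. p y v"
  let ?q = "\<lambda>y. \<kappa> y a (?s y)"
  have Cq: "C_on 2 S ?q" by (rule C_on_bilinear_family[OF S(1) \<kappa>_bilinear C\<kappa> C_on_const Cp])
  have g_q: "g y v ?w = f y * ?q y" if y: "y \<in> S" for y
    by (simp add: g_eq[OF y] h_vertical[OF y] p_vertical[OF y] \<kappa>_sym[OF y, of a])
  have "dird v (dird ?w (\<lambda>y. g y v ?w)) x = dird v (dird ?w (\<lambda>y. f y * ?q y)) x"
    by (rule dird_cong[OF S dird_cong[OF S(1) _ g_q]])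
  also have "\<dots> = f x * dird v (dird ?w ?q) x"
    by (subst dird_dird_mult_critical[OF S Cf Cq critical]) (simp add: v \<kappa>_simps)
  also have "dird v (dird ?w ?q) x = dird v (\<lambda>y. dird ?w (\<lambda>z. \<kappa> z a (?s y)) y + \<kappa> y a (dird ?w ?s y)) x"
  proof (rule dird_cong[OF S])
    fix y assume y: "y \<in> S"
    show "dird ?w ?q y = dird ?w (\<lambda>z. \<kappa> z a (?s y)) y + \<kappa> y a (dird ?w ?s y)"
      by (subst dird_\<kappa>_family[OF y differentiable_const dp[OF y]])
        (simp add: bilinear_lzero[OF \<kappa>_bilinear[OF y]])
  qed
  also have "\<dots> = dird v (\<lambda>y. dird ?w (\<lambda>z. \<kappa> z a (?s y)) y) x + dird v (\<lambda>y. \<kappa> y a (dird ?w ?s y)) x"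
    by (rule dird_add[OF differentiable_dird_\<kappa>[OF differentiable_const dp[OF S(2)]]
      differentiable_\<kappa>_family[OF S(2) differentiable_const ddp[OF S(2)]]])
  also have "dird v (\<lambda>y. dird ?w (\<lambda>z. \<kappa> z a (?s y)) y) x = dird ?w (\<lambda>y. \<kappa> y a (dird v ?s x)) x"
    unfolding dird_dird_\<kappa>[OF differentiable_const dp[OF S(2)]]
    by (simp add: v dird_\<kappa>_zero[OF S(2)] dird_dird_\<kappa>_zero)
  finally show ?thesis .
qed

text \<open>Away from \<open>x\<close> the vector \<open>v\<close> has the vertical part \<open>p y v\<close>, so that \<open>geodesic\<close> applies to
  \<open>v - (p y v, 0)\<close> only.\<close>

lemma second_dird_horizontal: "dird v (dird v (\<lambda>y. g y (a, 0) (a, 0))) x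
    = f x * (dird (dird v (\<lambda>y. p y v) x, 0) (\<lambda>y. \<kappa> y a a) x
      + 2 * dird v (\<lambda>y. \<kappa> y a (dird (a, 0) (\<lambda>y. p y v) y)) x)
      + \<kappa> x a a * dird v (dird v f) x"
proof -
  let ?w = "(a, 0)" and ?s = "\<lambda>y. p y v" and ?q = "\<lambda>y. \<kappa> y a a"
  have g_q: "g y ?w ?w = f y * ?q y" if y: "y \<in> S" for y
    by (simp add: g_eq[OF y] h_vertical[OF y] p_vertical[OF y])
  have "dird v (dird v (\<lambda>y. g y ?w ?w)) x = dird v (dird v (\<lambda>y. f y * ?q y)) x"
    by (rule dird_cong[OF S dird_cong[OF S(1) _ g_q]])
  also have "\<dots> = f x * dird v (dird v ?q) x + \<kappa> x a a * dird v (dird v f) x"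
    by (rule dird_dird_mult_critical[OF S Cf C\<kappa> critical])
  also have "dird v (dird v ?q) x = dird v (\<lambda>y. dird (?s y, 0) ?q y + 2 * \<kappa> y a (dird ?w ?s y)) x"
  proof (rule dird_cong[OF S])
    fix y assume y: "y \<in> S"
    let ?z = "v - (?s y, 0)"
    have "p y ?z = 0"
      using linear_diff[OF p[OF y]] p_vertical[OF y] by simp
    \<comment> \<open>\<open>?z\<close> is frozen at \<open>y\<close>, and \<open>p\<close> is
      constant on its vertical summand.\<close>
    moreover have "dird ?w (\<lambda>y'. p y' ?z) y = dird ?w ?s y"
      using linear_diff[OF linear_dird_family[OF S(1) y p dp[OF y]], of ?w v "(?s y, 0)"]
        dird_p_vertical[OF y] by simp
    ultimately have "dird ?z ?q y = 2 * \<kappa> y a (dird ?w ?s y)"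
      using geodesic[OF y, of ?z a a] by simp
    moreover have "dird v ?q y = dird (?s y, 0) ?q y + dird ?z ?q y"
      using linear_add[OF linear_dird[of ?q, OF d\<kappa>[OF y]], of "(?s y, 0)" ?z] by simp
    ultimately show "dird v ?q y = dird (?s y, 0) ?q y + 2 * \<kappa> y a (dird ?w ?s y)" by simp
  qed
  also have "\<dots> = dird v (\<lambda>y. dird (?s y, 0) ?q y) x + dird v (\<lambda>y. 2 * \<kappa> y a (dird ?w ?s y)) x"
  proof (rule dird_add)
    show "(\<lambda>y. dird (?s y, 0) ?q y) differentiable (at x)"
      using has_derivative_linear_family[OF S, of "\<lambda>y c. dird (c, 0) ?q y" ?s,
            OF linear_dird_\<kappa> dd\<kappa>[OF S(2)] dp[OF S(2)]]
      unfolding differentiable_def by blast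
    show "(\<lambda>y. 2 * \<kappa> y a (dird ?w ?s y)) differentiable (at x)"
      by (rule differentiable_mult[OF differentiable_const
          differentiable_\<kappa>_family[OF S(2) differentiable_const ddp[OF S(2)]]])
  qed
  also have "dird v (\<lambda>y. 2 * \<kappa> y a (dird ?w ?s y)) x = 2 * dird v (\<lambda>y. \<kappa> y a (dird ?w ?s y)) x"
    by (rule dird_cmult[OF differentiable_\<kappa>_family[OF S(2) differentiable_const ddp[OF S(2)]]])
  \<comment> \<open>The direction \<open>(p y v, 0)\<close> vanishes at \<open>x\<close>, so only
    its own derivative survives and no second derivative of \<open>\<kappa>\<close> remains.\<close>
  also have "dird v (\<lambda>y. dird (?s y, 0) ?q y) x = dird (dird v ?s x, 0) ?q x"
  proof -
    have "dird v (\<lambda>y. dird (0, 0) ?q y) x = dird v (\<lambda>_. 0) x"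
      by (rule dird_cong[OF S]) (use linear_0[OF linear_dird[OF d\<kappa>]] in \<open>simp add: zero_prod_def\<close>)
    then show ?thesis
      using dird_eqI[OF has_derivative_linear_family[OF S, of "\<lambda>y c. dird (c, 0) ?q y" ?s,
            OF linear_dird_\<kappa> dd\<kappa>[OF S(2)] dp[OF S(2)]]]
      by (simp add: v)
  qed
  finally show ?thesis .
qed

text \<open>In the coordinate formula the second vertical derivative of \<open>g y v v\<close>
  cancels the norm of the mixed Christoffel symbol. The terms with \<open>\<kappa>\<close>
  differentiated cancel between the other second derivatives and the product of the pure Christoffel
  symbols. The Hessian of \<open>f\<close> is left.\<close>

lemma curvature_critical:
  "2 * g x (curvature_tensor g x v (a, 0) (a, 0)) v = - \<kappa> x a a * dird v (dird v f) x"
proof -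
  have "g x (christoffel g x v v) (christoffel g x (a, 0) (a, 0))
      = g x (christoffel g x (a, 0) (a, 0)) (christoffel g x v v)"
    using g[OF S(2)] unfolding inner_form_def by blast
  then show ?thesis
    using curvature_tensor_coordinates[OF S g Cg, of v "(a, 0)"] christoffel_vertical[of "christoffel g x v v"]
    unfolding second_dird_mixed second_dird_horizontal second_dird_vertical christoffel_mixed_norm
      christoffel_horizontal by (simp add: algebra_simps)
qed

end

section \<open>The kernel vector and the nonpositively curved plane\<close>

lemma lift_horizontal:
  assumes "p x z = 0"
  shows "z = (- p x (0, snd z), snd z)"
proof -
  have "z = (fst z, 0) + (0, snd z)" by simp
  then have "p x z = fst z + p x (0, snd z)"
    using linear_add[OF p[OF S(2)]] p_vertical[OF S(2)] by metis
  then show ?thesis using assms by (simp add: prod_eq_iff eq_neg_iff_add_eq_0)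
qed

text \<open>The form is pulled back to \<open>'h\<close> along the horizontal lift \<open>l\<close>,
  which turns odd codimension into odd dimension of the whole space. The stronger
  \<open>snd v \<noteq> 0\<close> later makes \<open>v\<close> independent of vertical
  vectors.\<close>

lemma exists_kernel:
  assumes "odd DIM('h)"
  obtains v where "p x v = 0" "snd v \<noteq> 0"
    "\<And>z. p x z = 0 \<Longrightarrow> \<kappa> x a (dird v (\<lambda>y. p y z) x) = \<kappa> x a (dird z (\<lambda>y. p y v) x)"
proof -
  define l where "l t = (- p x (0, t), t)" for t :: 'h
  have l: "linear l"
    unfolding l_def[abs_def]
  proof (rule linearI)
    show "(- p x (0, s + t), s + t) = (- p x (0, s), s) + (- p x (0, t), t)" for s t
      using linear_add[OF p[OF S(2)], of "(0, s)" "(0, t)"] by simp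
    show "(- p x (0, r *\<^sub>R t), r *\<^sub>R t) = r *\<^sub>R (- p x (0, t), t)" for r t
      using linear_cmul[OF p[OF S(2)], of r "(0, t)"] by simp
  qed
  have pl: "p x (l t) = 0" for t
  proof -
    have "p x (l t) = p x ((- p x (0, t), 0) + (0, t))" by (simp add: l_def)
    then show ?thesis unfolding linear_add[OF p[OF S(2)]] p_vertical[OF S(2)] by simp
  qed
  define A where "A s t = dird (l s) (\<lambda>y. p y (l t)) x" for s t
  have A: "bilinear A"
    unfolding bilinear_def A_def
    using linear_compose[OF l linear_dird[OF dp[OF S(2)]]]
      linear_compose[OF l linear_dird_family[OF S p dp[OF S(2)]]] by (simp add: o_def)
  define \<omega> where "\<omega> s t = \<kappa> x a (A s t - A t s)" for s t
  have "bilinear \<omega>"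
    unfolding bilinear_def \<omega>_def
    by (intro conjI allI linearI) (simp_all add: bilinear_ladd[OF A] bilinear_radd[OF A]
        bilinear_lmul[OF A] bilinear_rmul[OF A] \<kappa>_simps algebra_simps)
  moreover have "\<omega> s t = - \<omega> t s" for s t
    by (simp add: \<omega>_def \<kappa>_simps)
  ultimately have "\<exists>t\<in>UNIV. t \<noteq> 0 \<and> (\<forall>s\<in>UNIV. \<omega> t s = 0)"
    by (rule skew_form_kernel) (use assms in simp_all)
  then obtain t where t: "t \<noteq> 0" "\<And>s. \<omega> t s = 0" by blast
  have "\<kappa> x a (dird (l t) (\<lambda>y. p y z) x) = \<kappa> x a (dird z (\<lambda>y. p y (l t)) x)" if "p x z = 0" for z
  proof -
    have "z = l (snd z)" unfolding l_def by (rule lift_horizontal[OF that])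
    then show ?thesis using t(2)[of "snd z"] by (simp add: \<omega>_def A_def \<kappa>_simps)
  qed
  then show ?thesis using that[of "l t"] pl t(1) by (simp add: l_def)
qed

lemma nonpositive_plane:
  assumes odd: "odd DIM('h)" and hessian: "\<And>v. dird v (dird v f) x \<ge> 0"
  shows "\<exists>v w. v \<noteq> w \<and> independent {v, w} \<and> sectional_curvature g x v w \<le> 0"
proof -
  obtain a :: 'v where a: "a \<noteq> 0" using nonempty_Basis nonzero_Basis by blast
  obtain v where v: "p x v = 0" "snd v \<noteq> 0"
    "\<And>z. p x z = 0 \<Longrightarrow> \<kappa> x a (dird v (\<lambda>y. p y z) x) = \<kappa> x a (dird z (\<lambda>y. p y v) x)"
    using exists_kernel[OF odd] by blast
  let ?w = "(a, 0)"
  have ne: "v \<noteq> ?w" using v(2) by auto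
  have "independent {v, ?w}"
  proof (rule independent_if_scalars_zero)
    fix c y assume "(\<Sum>y\<in>{v, ?w}. c y *\<^sub>R y) = 0" and y: "y \<in> {v, ?w}"
    then have sum: "c v *\<^sub>R v + c ?w *\<^sub>R ?w = 0" using ne by simp
    from arg_cong[OF this, of snd] have "c v = 0" using v(2) by simp
    moreover from this sum have "c ?w = 0" using a by (simp add: zero_prod_def)
    ultimately show "c y = 0" using y by blast
  qed simp
  moreover have "sectional_curvature g x v ?w \<le> 0"
    unfolding sectional_curvature_def
  proof (rule divide_nonpos_nonneg)
    have "2 * g x (curvature_tensor g x v ?w ?w) v = - \<kappa> x a a * dird v (dird v f) x"
      by (rule curvature_critical[OF v(1) v(3)])
    moreover have "0 \<le> \<kappa> x a a * dird v (dird v f) x"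
      by (rule mult_nonneg_nonneg[OF inner_form_nonneg[OF \<kappa>[OF S(2)]] hessian])
    ultimately show "g x (curvature_tensor g x v ?w ?w) v \<le> 0" by linarith
    \<comment> \<open>By orthogonality the denominator is a product of two squared lengths.\<close>
    have "g x v ?w = 0"
      by (simp add: g_eq[OF S(2)] h_vertical[OF S(2)] v(1) \<kappa>_simps)
    then show "0 \<le> g x v v * g x ?w ?w - (g x v ?w)\<^sup>2"
      using inner_form_nonneg[OF g[OF S(2)]] by simp
  qed
  ultimately show ?thesis using ne by blast
qed

end

section \<open>Minima and foliated charts\<close>

lemma has_vector_derivative_along_line:
  assumes "f differentiable (at (x + t *\<^sub>R v))"
  shows "((\<lambda>t. f (x + t *\<^sub>R v)) has_vector_derivative dird v f (x + t *\<^sub>R v)) (at t)"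
proof -
  have "((\<lambda>t. x + t *\<^sub>R v) has_derivative (\<lambda>s. 0 + s *\<^sub>R v)) (at t)"
    by (intro has_derivative_add has_derivative_const has_derivative_scaleR_left has_derivative_ident)
  from has_derivative_compose[OF this has_derivative_dird[OF assms]]
  show ?thesis
    unfolding has_vector_derivative_def
    using linear_cmul[OF linear_dird[OF assms]] by simp
qed

text \<open>The line may leave the chart. This is harmless for \<open>h\<close>, whose formula
  depends on the point only through \<open>snd\<close>.\<close>

lemma dird_constant_along_line:
  assumes "f differentiable (at x)" "\<And>t. f (x + t *\<^sub>R v) = f x"
  shows "dird v f x = 0"
proof -
  have "((\<lambda>_. f x) has_vector_derivative dird v f x) (at 0)"
    using has_vector_derivative_along_line[of f x 0 v] assms by simp
  then show ?thesis
    using vector_derivative_unique_at has_vector_derivative_const by blast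
qed

lemma dird_local_min:
  fixes f :: "'e::real_normed_vector \<Rightarrow> real"
  assumes "open S" "x \<in> S" "f differentiable (at x)" "\<And>y. y \<in> S \<Longrightarrow> f x \<le> f y"
  shows "dird v f x = 0"
  using fun_cong[OF differential_zero_maxmin[OF assms(2,1) has_derivative_dird[OF assms(3)]], of v] assms(4)
  by blast

text \<open>A negative second derivative would make the first derivative negative just after the
  minimum, and by the mean value theorem \<open>f\<close> would drop below its minimum.\<close>

lemma second_dird_local_min:
  fixes f :: "'e::real_normed_vector \<Rightarrow> real"
  assumes S: "open S" "x \<in> S" and Cf: "C_on 2 S f" and min: "\<And>y. y \<in> S \<Longrightarrow> f x \<le> f y"
  shows "dird v (dird v f) x \<ge> 0"
proof (rule ccontr)
  assume neg: "\<not> dird v (dird v f) x \<ge> 0"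
  have Cf': "C_on (Suc (Suc 0)) S f" using Cf by (simp add: numeral_2_eq_2)
  note df = C_on_Suc_differentiable[OF Cf'] and ddf = C_on_Suc_differentiable[OF C_on_dird[OF Cf']]
  define \<psi> where "\<psi> t = dird v f (x + t *\<^sub>R v)" for t
  have "((\<lambda>t. dird v f (x + t *\<^sub>R v)) has_vector_derivative dird v (dird v f) x) (at 0)"
    using has_vector_derivative_along_line[of "dird v f" x 0 v] ddf[OF S(2)] by simp
  then have "DERIV \<psi> 0 :> dird v (dird v f) x"
    unfolding \<psi>_def[abs_def] by (simp add: has_real_derivative_iff_has_vector_derivative)
  then have "\<exists>d>0. \<forall>h>0. h < d \<longrightarrow> \<psi> 0 > \<psi> (0 + h)"
    by (rule DERIV_neg_dec_right) (use neg in simp)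
  then obtain d where d: "d > 0" "\<And>h. h > 0 \<Longrightarrow> h < d \<Longrightarrow> \<psi> h < \<psi> 0"
    by auto
  have \<psi>0: "\<psi> 0 = 0"
    using dird_local_min[OF S df[OF S(2)] min] by (simp add: \<psi>_def)
  obtain e where e: "e > 0" "ball x e \<subseteq> S" using S openE by blast
  \<comment> \<open>The summand 1 keeps the quotient positive for \<open>v = 0\<close>.\<close>
  define \<epsilon> where "\<epsilon> = e / (norm v + 1)"
  define h where "h = min (d / 2) (\<epsilon> / 2)"
  have pos: "norm v + 1 > 0" by (simp add: add_nonneg_pos)
  have \<epsilon>: "\<epsilon> > 0" using e(1) pos by (simp add: \<epsilon>_def)
  then have h: "0 < h" "h < d" "h < \<epsilon>"
    using d(1) by (auto simp: h_def min_def)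
  have inS: "x + t *\<^sub>R v \<in> S" if t: "0 \<le> t" "t \<le> h" for t
  proof -
    have "t * norm v \<le> h * (norm v + 1)" using t by (intro mult_mono) auto
    also have "\<dots> < e" using h(3) pos by (simp add: \<epsilon>_def pos_less_divide_eq)
    finally have "x + t *\<^sub>R v \<in> ball x e" using t by (simp add: dist_norm)
    then show ?thesis using e by blast
  qed
  have "DERIV (\<lambda>t. f (x + t *\<^sub>R v)) t :> \<psi> t" if "0 \<le> t" "t \<le> h" for t
    using has_vector_derivative_along_line[OF df[OF inS[OF that]]]
    by (simp add: \<psi>_def has_real_derivative_iff_has_vector_derivative)
  from MVT2[OF h(1) this] obtain t where t: "t > 0" "t < h"
    "f (x + h *\<^sub>R v) - f (x + 0 *\<^sub>R v) = (h - 0) * \<psi> t" by blast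
  have "\<psi> t < 0" using d(2)[of t] t h \<psi>0 by simp
  then have "(h - 0) * \<psi> t < 0" using h(1) by (simp add: mult_pos_neg)
  then show False using t(3) min[OF inS[of h]] h(1) by simp
qed

section \<open>Charts, plaques and the vertical space\<close>

lemma chart_subset: "is_chart X c \<Longrightarrow> fst c \<subseteq> topspace X"
  by (simp add: is_chart_def openin_subset)

lemma chart_inv_image:
  assumes "is_chart X c"
  shows "x \<in> chart_image c \<Longrightarrow> chart_inv c x \<in> fst c" "x \<in> chart_image c \<Longrightarrow> snd c (chart_inv c x) = x"
  by (simp_all add: chart_inv_def inv_into_into f_inv_into_f)

lemma chart_inv_chart:
  assumes "is_chart X c" "q \<in> fst c"
  shows "chart_inv c (snd c q) = q"
proof -
  have "inj_on (snd c) (fst c)"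
    using assms(1) chart_subset[OF assms(1)]
    by (simp add: is_chart_def homeomorphic_eq_everything_map Int_absorb1)
  then show ?thesis using assms(2) by (simp add: chart_inv_def)
qed

lemma continuous_map_chart_inv:
  assumes "is_chart X c"
  shows "continuous_map (top_of_set (chart_image c)) (subtopology X (fst c)) (chart_inv c)"
proof -
  obtain k where k: "homeomorphic_maps (subtopology X (fst c)) (top_of_set (chart_image c)) (snd c) k"
    using assms by (auto simp: is_chart_def homeomorphic_map_maps)
  have "k y = chart_inv c y" if "y \<in> chart_image c" for y
    using k that chart_inv_image[OF assms that] chart_subset[OF assms]
    unfolding homeomorphic_maps_def by (auto simp: Int_absorb1)
  then show ?thesis
    using k unfolding homeomorphic_maps_def by (auto intro: continuous_map_eq)
qed

text \<open>A curve in the leaf stays in one path component within the chart, that is in a plaque,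
  so its \<open>snd\<close> is constant. Conversely a short segment in a direction with
  \<open>snd v = 0\<close> stays in the plaque, hence in the leaf.\<close>

lemma vertical_space_foliated_chart:
  fixes c :: "('m, 'v::euclidean_space \<times> 'h::euclidean_space) chart"
  assumes c: "is_chart X c" and F: "partition_on (topspace X) F" and fol: "foliated_chart X F c"
    and x: "x \<in> chart_image c"
  shows "vertical_space F c x = {v. snd v = 0}"
proof (intro equalityI subsetI CollectI)
  fix v assume "v \<in> vertical_space F c x"
  then obtain L \<gamma> \<epsilon> where L: "L \<in> F" and \<epsilon>: "\<epsilon> > (0::real)"
    and \<gamma>: "\<gamma> ` {-\<epsilon><..<\<epsilon>} \<subseteq> snd c ` (fst c \<inter> L)" "smooth_on {-\<epsilon><..<\<epsilon>} \<gamma>" "\<gamma> 0 = x"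
    and der: "(\<gamma> has_vector_derivative v) (at 0)"
    unfolding vertical_space_def by blast
  define p where "p = chart_inv c x"
  let ?I = "{-\<epsilon><..<\<epsilon>}"
  have inL: "chart_inv c (\<gamma> t) \<in> fst c \<inter> L" "\<gamma> t \<in> chart_image c" if t: "t \<in> ?I" for t
  proof -
    obtain q where "q \<in> fst c \<inter> L" "\<gamma> t = snd c q" using \<gamma>(1) t by blast
    then show "chart_inv c (\<gamma> t) \<in> fst c \<inter> L" "\<gamma> t \<in> chart_image c"
      using chart_inv_chart[OF c, of q] by auto
  qed
  have 0: "0 \<in> ?I" using \<epsilon> by simp
  have "C_on 0 ?I \<gamma>" using \<gamma>(2) unfolding smooth_on_def by blast
  then have "continuous_on ?I \<gamma>" by simp
  then have "continuous_map (top_of_set ?I) (top_of_set (chart_image c)) \<gamma>"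
    using inL(2) by auto
  then have "continuous_map (top_of_set ?I) (subtopology X (fst c)) (chart_inv c \<circ> \<gamma>)"
    by (rule continuous_map_compose[OF _ continuous_map_chart_inv[OF c]])
  then have "continuous_map (top_of_set ?I) X (chart_inv c \<circ> \<gamma>)"
    by (rule continuous_map_into_fulltopology)
  moreover have "path_connectedin (top_of_set ?I) ?I"
    by (simp add: path_connectedin_subtopology convex_imp_path_connected)
  ultimately have "path_connectedin X ((chart_inv c \<circ> \<gamma>) ` ?I)"
    by (rule path_connectedin_continuous_map_image)
  then have "path_connectedin (subtopology X (fst c \<inter> L)) ((chart_inv c \<circ> \<gamma>) ` ?I)"
    using inL(1) by (auto simp: path_connectedin_subtopology)
  then have "(chart_inv c \<circ> \<gamma>) ` ?I \<subseteq> path_component_of_set (subtopology X (fst c \<inter> L)) p"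
    by (rule path_component_of_maximal) (use 0 \<gamma>(3) in \<open>auto simp: p_def image_iff intro!: bexI[of _ 0]\<close>)
  moreover have pL: "p \<in> fst c \<inter> L" using inL(1)[OF 0] \<gamma>(3) by (simp add: p_def)
  ultimately have "snd (snd c (chart_inv c (\<gamma> t))) = snd (snd c p)" if "t \<in> ?I" for t
    using fol L that unfolding foliated_chart_def by fastforce
  then have const: "snd (\<gamma> t) = snd x" if "t \<in> ?I" for t
    using chart_inv_image(2)[OF c inL(2)[OF that]] chart_inv_image(2)[OF c x] that
    by (metis p_def)
  have "((\<lambda>t. snd (\<gamma> t)) has_vector_derivative snd v) (at 0)"
    using bounded_linear.has_vector_derivative[OF bounded_linear_snd der] .
  then have "((\<lambda>_. snd x) has_vector_derivative snd v) (at 0)"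
    by (rule has_vector_derivative_transform_within_open[of _ _ _ ?I]) (use 0 const in auto)
  then show "snd v = 0"
    using vector_derivative_unique_at has_vector_derivative_const by blast
next
  fix v :: "'v \<times> 'h" assume "v \<in> {v. snd v = 0}"
  then have v: "snd v = 0" by simp
  define p where "p = chart_inv c x"
  have p: "p \<in> fst c" "snd c p = x" using chart_inv_image[OF c x] by (simp_all add: p_def)
  obtain L where L: "L \<in> F" "p \<in> L"
    using F p(1) chart_subset[OF c] unfolding partition_on_def by blast
  have comp: "path_component_of_set (subtopology X (fst c \<inter> L)) p = {q \<in> fst c. snd (snd c q) = snd x}"
    using fol L p unfolding foliated_chart_def by blast
  have "open (chart_image c)" using c by (simp add: is_chart_def)
  then obtain e where e: "e > 0" "ball x e \<subseteq> chart_image c" using x openE by blast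
  define \<epsilon> where "\<epsilon> = e / (norm v + 1)"
  have pos: "norm v + 1 > 0" by (simp add: add_nonneg_pos)
  have \<epsilon>: "\<epsilon> > 0" using e(1) pos by (simp add: \<epsilon>_def)
  let ?\<gamma> = "\<lambda>t. x + t *\<^sub>R v" and ?I = "{-\<epsilon><..<\<epsilon>}"
  have "?\<gamma> t \<in> snd c ` (fst c \<inter> L)" if t: "t \<in> ?I" for t
  proof -
    have "\<bar>t\<bar> * norm v \<le> \<bar>t\<bar> * (norm v + 1)" by (intro mult_left_mono) auto
    also have "\<dots> < \<epsilon> * (norm v + 1)" using t pos by (intro mult_strict_right_mono) auto
    also have "\<dots> = e" using pos by (simp add: \<epsilon>_def)
    finally have im: "?\<gamma> t \<in> chart_image c" using e(2) by (auto simp: dist_norm)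
    define q where "q = chart_inv c (?\<gamma> t)"
    have q: "q \<in> fst c" "snd c q = ?\<gamma> t" using chart_inv_image[OF c im] by (simp_all add: q_def)
    then have "q \<in> path_component_of_set (subtopology X (fst c \<inter> L)) p" using v comp by simp
    then have "q \<in> L"
      using path_component_of_subset_topspace[of "subtopology X (fst c \<inter> L)" p] by auto
    then show ?thesis using q by (metis IntI imageI)
  qed
  moreover have "smooth_on ?I ?\<gamma>"
    unfolding smooth_on_def
  proof
    have "C_on k ?I (\<lambda>t. t)" for k :: nat
    proof (cases k)
      case (Suc n)
      have "dird w (\<lambda>t. t) = (\<lambda>_. w)" for w :: real
        by (rule ext) (rule dird_eqI[OF has_derivative_ident])
      then show ?thesis unfolding Suc by (simp add: C_on_Suc_dird C_on_const)
    qed simp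
    then show "C_on k ?I ?\<gamma>" for k
      by (intro C_on_add C_on_scaleR C_on_const open_greaterThanLessThan)
  qed
  moreover have "(?\<gamma> has_vector_derivative v) (at 0)"
    by (auto intro!: derivative_eq_intros)
  ultimately show "v \<in> vertical_space F c x"
    unfolding vertical_space_def using L(1) \<epsilon>
    by (intro CollectI bexI[of _ L] exI[of _ ?\<gamma>] exI[of _ \<epsilon>]) auto
qed

lemma smooth_function_attains_min:
  assumes "smooth_manifold X A" "compact_space X" "topspace X \<noteq> {}" "smooth_function A \<phi>"
  obtains p where "p \<in> topspace X" "\<And>q. q \<in> topspace X \<Longrightarrow> \<phi> p \<le> \<phi> q"
proof -
  have chart: "is_chart X c" if "c \<in> A" for c using assms(1) that by (simp add: smooth_manifold_def)
  have "continuous_map X euclideanreal \<phi>"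
  proof (rule pasting_lemma[where I=A and T=fst and f="\<lambda>_. \<phi>"])
    fix c assume c: "c \<in> A"
    show "openin X (fst c)" using chart[OF c] by (simp add: is_chart_def)
    have "C_on 0 (chart_image c) (\<phi> \<circ> chart_inv c)"
      using assms(4) c unfolding smooth_function_def smooth_on_def by blast
    then have 1: "continuous_map (top_of_set (chart_image c)) euclideanreal (\<phi> \<circ> chart_inv c)" by simp
    have 2: "continuous_map (subtopology X (fst c)) (top_of_set (chart_image c)) (snd c)"
      using chart[OF c] by (simp add: is_chart_def homeomorphic_imp_continuous_map)
    show "continuous_map (subtopology X (fst c)) euclideanreal \<phi>"
      by (rule continuous_map_eq[OF continuous_map_compose[OF 2 1]]) (simp add: chart_inv_chart[OF chart[OF c]])
  next
    fix x assume "x \<in> topspace X"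
    then show "\<exists>j. j \<in> A \<and> x \<in> fst j \<and> \<phi> x = \<phi> x" using assms(1) unfolding smooth_manifold_def by blast
  qed simp
  then have "compact (\<phi> ` topspace X)"
    using image_compactin[of X "topspace X" euclideanreal \<phi>] assms(2) by (simp add: compact_space_def)
  then show ?thesis
    using compact_attains_inf[of "\<phi> ` topspace X"] assms(3) that by auto
qed

section \<open>Vertical projections and the main result\<close>

text \<open>The first component of the \<open>G\<close>-orthogonal projection onto the first factor; it is unique
  if \<open>G x\<close> is positive definite.\<close>

definition vproj :: "('e \<Rightarrow> 'v::real_vector \<times> 'h::real_vector \<Rightarrow> 'v \<times> 'h \<Rightarrow> real) \<Rightarrow> 'e \<Rightarrow> 'v \<times> 'h \<Rightarrow> 'v" where
  "vproj G x u = (SOME a. \<forall>b. G x (a, 0) (b, 0) = G x u (b, 0))"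

lemma linear_vertical: "linear l \<Longrightarrow> linear (\<lambda>a. l (a, 0))"
  using linear_compose[of "\<lambda>a. (a, 0)" l] by (simp add: linear_iff o_def)

lemma inner_form_vertical:
  assumes "inner_form (B :: 'v::real_vector \<times> 'h::real_vector \<Rightarrow> 'v \<times> 'h \<Rightarrow> real)"
  shows "inner_form (\<lambda>a b. B (a, 0) (b, 0))"
proof -
  have "linear (B u)" "linear (\<lambda>u. B u w)" for u w
    using assms unfolding inner_form_def bilinear_def by blast+
  then have "bilinear (\<lambda>a b. B (a, 0) (b, 0))"
    unfolding bilinear_def using linear_vertical[of "B _"] linear_vertical[of "\<lambda>u. B u _"] by blast
  then show ?thesis using assms by (auto simp: inner_form_def zero_prod_def)
qed

context
  fixes G :: "'e \<Rightarrow> 'v::euclidean_space \<times> 'h::euclidean_space \<Rightarrow> 'v \<times> 'h \<Rightarrow> real" and x :: 'e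
  assumes G: "inner_form (G x)"
begin

lemma G_bilinear: "bilinear (G x)" using G by (simp add: inner_form_def)

lemma vproj: "G x (vproj G x u, 0) (b, 0) = G x u (b, 0)"
proof -
  have "linear (G x u)" using G_bilinear unfolding bilinear_def by blast
  then have "linear (\<lambda>b. G x u (b, 0))" by (rule linear_vertical)
  from inner_form_representation[OF inner_form_vertical[OF G] this]
  have "\<forall>b. G x (vproj G x u, 0) (b, 0) = G x u (b, 0)"
    unfolding vproj_def by (rule someI_ex)
  then show ?thesis ..
qed

lemma vproj': "G x (b, 0) (vproj G x u, 0) = G x (b, 0) u"
  using vproj G unfolding inner_form_def by metis

lemma vproj_eqI: "(\<And>b. G x (a, 0) (b, 0) = G x u (b, 0)) \<Longrightarrow> vproj G x u = a"
  by (rule inner_form_eqI[OF inner_form_vertical[OF G]]) (simp add: vproj)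

lemma vproj_vertical: "vproj G x (a, 0) = a"
  by (rule vproj_eqI) simp

lemma linear_vproj: "linear (vproj G x)"
proof (rule linearI)
  show "vproj G x (u + w) = vproj G x u + vproj G x w" for u w
    using bilinear_ladd[OF G_bilinear, of "(vproj G x u, 0)" "(vproj G x w, 0)"]
    by (intro vproj_eqI) (simp add: bilinear_ladd[OF G_bilinear] vproj)
  show "vproj G x (r *\<^sub>R u) = r *\<^sub>R vproj G x u" for r u
    using bilinear_lmul[OF G_bilinear, of r "(vproj G x u, 0)"]
    by (intro vproj_eqI) (simp add: bilinear_lmul[OF G_bilinear] vproj)
qed

lemma vproj_horizontal: "G x (u - (vproj G x u, 0)) (b, 0) = 0"
  by (simp add: bilinear_lsub[OF G_bilinear] vproj)

text \<open>Pythagoras, polarised. It serves to read off both \<open>h\<close> and the warped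
  metric.\<close>

lemma vproj_split:
  "G x (u - (vproj G x u, 0)) (w - (vproj G x w, 0)) = G x u w - G x (vproj G x u, 0) (vproj G x w, 0)"
  by (simp add: bilinear_lsub[OF G_bilinear] bilinear_rsub[OF G_bilinear] vproj[of u "vproj G x w", symmetric]
      vproj'[of "vproj G x u" w, symmetric])

end

text \<open>The projection solves a linear equation whose form is the metric along the
  leaves.\<close>

lemma C_on_vproj:
  fixes G :: "'v::euclidean_space \<times> 'h::euclidean_space \<Rightarrow> 'v \<times> 'h \<Rightarrow> 'v \<times> 'h \<Rightarrow> real"
  assumes "open S" "\<And>y. y \<in> S \<Longrightarrow> inner_form (G y)" "\<And>u w. C_on k S (\<lambda>y. G y u w)"
  shows "C_on k S (\<lambda>y. vproj G y u)"
proof (rule C_on_inner_form_solution[OF assms(1), of "\<lambda>y a b. G y (a, 0) (b, 0)"])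
  show "inner_form (\<lambda>a b. G y (a, 0) (b, 0))" if "y \<in> S" for y
    by (rule inner_form_vertical[OF assms(2)[OF that]])
  show "linear (\<lambda>b. G y u (b, 0))" if "y \<in> S" for y
    using assms(2)[OF that] unfolding inner_form_def bilinear_def by (intro linear_vertical) blast
qed (rule assms(3), rule assms(3), rule vproj[of G, OF assms(2)])

lemma vertical_part_foliated_chart:
  fixes c :: "('m, 'v::euclidean_space \<times> 'h::euclidean_space) chart"
  assumes "inner_form (g c x)" and V: "vertical_space F c x = {v. snd v = 0}"
  shows "vertical_part F g c x u = (vproj (g c) x u, 0)"
  unfolding vertical_part_def V
proof (rule the_equality)
  show "(vproj (g c) x u, 0) \<in> {v. snd v = 0} \<and>
      (\<forall>\<eta>\<in>{v. snd v = 0}. g c x (u - (vproj (g c) x u, 0)) \<eta> = 0)"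
  proof (intro conjI ballI)
    fix \<eta> :: "'v \<times> 'h" assume "\<eta> \<in> {v. snd v = 0}"
    then have "\<eta> = (fst \<eta>, 0)" by (simp add: prod_eq_iff)
    then show "g c x (u - (vproj (g c) x u, 0)) \<eta> = 0"
      using vproj_horizontal[of "g c", OF assms(1)] by metis
  qed simp
  fix \<xi> :: "'v \<times> 'h" assume \<xi>: "\<xi> \<in> {v. snd v = 0} \<and> (\<forall>\<eta>\<in>{v. snd v = 0}. g c x (u - \<xi>) \<eta> = 0)"
  then have eq: "\<xi> = (fst \<xi>, 0)" by (simp add: prod_eq_iff)
  have "vproj (g c) x u = fst \<xi>"
  proof (rule vproj_eqI[of "g c", OF assms(1)])
    fix b
    have "g c x (u - (fst \<xi>, 0)) (b, 0) = 0" using \<xi> eq by (metis mem_Collect_eq snd_conv)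
    then show "g c x (fst \<xi>, 0) (b, 0) = g c x u (b, 0)"
      using assms(1) by (simp add: inner_form_def bilinear_lsub)
  qed
  then show "\<xi> = (vproj (g c) x u, 0)" using eq by simp
qed

theorem corollary1p1:
  fixes X :: "'m topology"
    and A :: "('m, 'v::euclidean_space \<times> 'h::euclidean_space) chart set"
    and g\<^sub>0 :: "('m, 'v \<times> 'h) tensor2"
    and F :: "'m set set"
    and \<phi> :: "'m \<Rightarrow> real"
  assumes "smooth_manifold X A"
    and "compact_space X"
    and "topspace X \<noteq> {}"
    and "riemannian_metric A g\<^sub>0"
    and "riemannian_foliation X A g\<^sub>0 F"
    and "totally_geodesic_leaves A g\<^sub>0 F"
    and "basic_function A F \<phi>"
    and "odd DIM('h)"
  shows "\<exists>c\<in>A. \<exists>x\<in>chart_image c. \<exists>v w. v \<noteq> w \<and> independent {v, w} \<and>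
    sectional_curvature (warped_metric F g\<^sub>0 \<phi> c) x v w \<le> 0"
proof -
  have smooth: "smooth_function A \<phi>" using assms(7) by (simp add: basic_function_def)
  obtain p where p: "p \<in> topspace X" "\<And>q. q \<in> topspace X \<Longrightarrow> \<phi> p \<le> \<phi> q"
    using smooth_function_attains_min[OF assms(1-3) smooth] by blast
  obtain c H where c: "c \<in> A" "p \<in> fst c" "foliated_chart X F c"
    and H: "metric_on (snd ` chart_image c) H"
    and sub: "riemannian_submersion (chart_image c) (g\<^sub>0 c) H snd"
    using assms(5) p(1) unfolding riemannian_foliation_def by blast
  have chart: "is_chart X c" using assms(1) c(1) by (simp add: smooth_manifold_def)
  define S where "S = chart_image c"
  define x where "x = snd c p"
  define G where "G = g\<^sub>0 c"
  define g where "g = warped_metric F g\<^sub>0 \<phi> c"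
  define f where "f y = exp (2 * (\<phi> \<circ> chart_inv c) y)" for y
  define \<kappa> where "\<kappa> y a b = G y (a, 0) (b, 0)" for y a b
  \<comment> \<open>The metric of the local leaf space pulled back by the submersion
    \<open>snd\<close>.\<close>
  define h where "h y u w = H (snd y) (snd u) (snd w)" for y u w :: "'v \<times> 'h"
  have S: "open S" "x \<in> S" using chart c(2) by (auto simp: S_def x_def is_chart_def)
  have part: "partition_on (topspace X) F"
    using assms(5) by (simp add: riemannian_foliation_def foliation_def)
  have V: "vertical_space F c y = {v. snd v = 0}" if "y \<in> S" for y
    using vertical_space_foliated_chart[OF chart part c(3)] that by (simp add: S_def)
  have metric: "metric_on S G"
    using assms(4) c(1) by (simp add: riemannian_metric_def S_def G_def)
  have G: "inner_form (G y)" if "y \<in> S" for y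
    using metric that by (simp add: metric_on_def inner_form_def)
  have CG: "C_on 2 S (\<lambda>y. G y u w)" for u w
    using metric unfolding metric_on_def smooth_on_def by blast
  have dG: "(\<lambda>y. G y u w) differentiable (at y)" if "y \<in> S" for y u w
    using C_on_Suc_differentiable[OF _ that, of 1] CG[of u w] by (simp add: numeral_2_eq_2)
  have blG: "bilinear (G y)" if "y \<in> S" for y using G[OF that] by (simp add: inner_form_def)
  let ?p = "vproj G"
  have vpart: "vertical_part F g\<^sub>0 c y u = (?p y u, 0)" if "y \<in> S" for y u
    using vertical_part_foliated_chart[of g\<^sub>0 c y F u] G[OF that] V[OF that] by (simp add: G_def)
  have h: "h y u w = G y u w - G y (?p y u, 0) (?p y w, 0)" if y: "y \<in> S" for y u w
  proof -
    have D: "frechet_derivative snd (at y) = (snd :: 'v \<times> 'h \<Rightarrow> 'h)"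
      using frechet_derivative_at[OF bounded_linear_imp_has_derivative[OF bounded_linear_snd]] by metis
    have "let P = frechet_derivative snd (at y); K = {k. P k = 0} in
        range P = UNIV \<and>
        (\<forall>u w. (\<forall>k\<in>K. G y u k = 0) \<and> (\<forall>k\<in>K. G y w k = 0) \<longrightarrow> H (snd y) (P u) (P w) = G y u w)"
      using sub y unfolding riemannian_submersion_def S_def G_def by (rule conjunct2[THEN bspec])
    then have H: "\<forall>u w. (\<forall>k\<in>{k. snd k = 0}. G y u k = 0) \<and> (\<forall>k\<in>{k. snd k = 0}. G y w k = 0)
        \<longrightarrow> H (snd y) (snd u) (snd w) = G y u w"
      unfolding D Let_def by (rule conjunct2)
    \<comment> \<open>To be applied to the horizontal parts of \<open>u\<close> and
      \<open>w\<close>, which have the same \<open>snd\<close> as \<open>u\<close> and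
      \<open>w\<close>.\<close>
    have "H (snd y) (snd u') (snd w') = G y u' w'"
      if "\<And>b. G y u' (b, 0) = 0" "\<And>b. G y w' (b, 0) = 0" for u' w'
    proof -
      have "k = (fst k, 0)" if "k \<in> {k. snd k = 0}" for k :: "'v \<times> 'h"
        using that by (simp add: prod_eq_iff)
      then show ?thesis using H that by metis
    qed
    from this[of "u - (?p y u, 0)" "w - (?p y w, 0)"] show ?thesis
      using vproj_horizontal[of G, OF G[OF y]] vproj_split[of G, OF G[OF y]] by (simp add: h_def)
  qed
  have g_eq: "g y u w = f y * \<kappa> y (?p y u) (?p y w) + h y u w" if y: "y \<in> S" for y u w
    using vproj_split[of G, OF G[OF y], of u w] h[OF y, of u w]
    by (simp add: g_def warped_metric_def horizontal_part_def vpart[OF y] G_def[symmetric] f_def \<kappa>_def)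
  have Cp: "C_on 2 S (\<lambda>y. ?p y u)" for u by (rule C_on_vproj[OF S(1) G CG])
  have dp: "(\<lambda>y. ?p y u) differentiable (at y)" if "y \<in> S" for y u
    using C_on_Suc_differentiable[OF _ that, of 1] Cp[of u] by (simp add: numeral_2_eq_2)
  have \<kappa>: "inner_form (\<kappa> y)" if "y \<in> S" for y
    unfolding \<kappa>_def[abs_def] by (rule inner_form_vertical[OF G[OF that]])
  have bl\<kappa>: "bilinear (\<kappa> y)" if "y \<in> S" for y using \<kappa>[OF that] by (simp add: inner_form_def)
  have C\<kappa>: "C_on 2 S (\<lambda>y. \<kappa> y a b)" for a b unfolding \<kappa>_def by (rule CG)
  have d\<kappa>: "(\<lambda>y. \<kappa> y a b) differentiable (at y)" if "y \<in> S" for y a b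
    unfolding \<kappa>_def by (rule dG[OF that])
  have Ch: "C_on 2 S (\<lambda>y. h y u w)" for u w
  proof (rule C_on_congI[OF _ S(1)])
    show "C_on 2 S (\<lambda>y. G y u w - \<kappa> y (?p y u) (?p y w))"
      by (rule C_on_diff[OF S(1) CG C_on_bilinear_family[OF S(1) bl\<kappa> C\<kappa> Cp Cp]])
  qed (simp add: h \<kappa>_def)
  have "C_on 2 S (\<phi> \<circ> chart_inv c)"
    using smooth c(1) unfolding smooth_function_def smooth_on_def S_def by blast
  then have Cf: "C_on 2 S f"
    unfolding f_def[abs_def] by (intro C_on_exp C_on_mult S(1) C_on_const)
  have fpos: "f y > 0" for y by (simp add: f_def)
  have min: "f x \<le> f y" if "y \<in> S" for y
  proof -
    have "chart_inv c x = p" using chart_inv_chart[OF chart c(2)] by (simp add: x_def)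
    moreover have "chart_inv c y \<in> topspace X"
      using chart_inv_image(1)[OF chart] chart_subset[OF chart] that unfolding S_def by blast
    ultimately show ?thesis using p(2) by (simp add: f_def)
  qed
  have G_\<kappa>: "G y u (b, 0) = \<kappa> y (?p y u) b" "G y (b, 0) u = \<kappa> y b (?p y u)" if "y \<in> S" for y u b
    using vproj[of G, OF G[OF that]] vproj'[of G, OF G[OF that]] by (simp_all add: \<kappa>_def)
  have geodesic: "dird z (\<lambda>y. \<kappa> y a b) y
      = \<kappa> y b (dird (a, 0) (\<lambda>y. ?p y z) y) + \<kappa> y a (dird (b, 0) (\<lambda>y. ?p y z) y)"
    if y: "y \<in> S" and z: "?p y z = 0" for y z a b
  proof -
    \<comment> \<open>Constant vertical fields suffice: their covariant derivative is a Christoffel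
      vector, which is thus vertical and orthogonal to \<open>z\<close>. The Koszul formula turns
      this into the claim.\<close>
    have field: "vertical_field F c (\<lambda>_. (a, 0))" for a
      using V by (simp add: vertical_field_def smooth_on_def C_on_const S_def)
    let ?\<Gamma> = "christoffel G y (a, 0) (b, 0)"
    have "horizontal_part F g\<^sub>0 c y (cov_deriv G (\<lambda>_. (a, 0)) (\<lambda>_. (b, 0)) y) = 0"
      using assms(6) c(1) field y unfolding totally_geodesic_leaves_def S_def G_def by blast
    then have "?\<Gamma> = (?p y ?\<Gamma>, 0)"
      by (simp add: horizontal_part_def vpart[OF y] cov_deriv_def)
    then have "G y ?\<Gamma> z = G y (?p y ?\<Gamma>, 0) z" by (rule arg_cong)
    then have 1: "G y ?\<Gamma> z = 0"
      using G_\<kappa>(2)[OF y] z bilinear_rzero[OF bl\<kappa>[OF y]] by simp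
    \<comment> \<open>Since \<open>?p y z = 0\<close>, the derivative of \<open>\<kappa>\<close>
      does not contribute.\<close>
    have 2: "dird d (\<lambda>y. G y (e, 0) z) y = \<kappa> y e (dird d (\<lambda>y. ?p y z) y)" for d e
    proof -
      have "dird d (\<lambda>y. G y (e, 0) z) y = dird d (\<lambda>y. \<kappa> y e (?p y z)) y"
        by (rule dird_cong[OF S(1) y]) (rule G_\<kappa>(2))
      also have "\<dots> = dird d (\<lambda>y'. \<kappa> y' e 0) y + \<kappa> y e (dird d (\<lambda>y. ?p y z) y)"
        using dird_bilinear_family[OF S(1) y bl\<kappa> d\<kappa>[OF y] differentiable_const dp[OF y], of d e z]
        by (simp add: z bilinear_lzero[OF bl\<kappa>[OF y]])
      also have "dird d (\<lambda>y'. \<kappa> y' e 0) y = dird d (\<lambda>_. 0) y"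
        by (rule dird_cong[OF S(1) y]) (rule bilinear_rzero[OF bl\<kappa>])
      finally show ?thesis by simp
    qed
    show ?thesis
      using christoffel_koszul[OF S(1) y G dG[OF y], of "(a, 0)" "(b, 0)" z]
      unfolding 1 2 \<kappa>_def[symmetric] by simp
  qed
  have dh: "(\<lambda>y. h y u w) differentiable (at y)" if "y \<in> S" for y u w
    using C_on_Suc_differentiable[OF _ that, of 1] Ch[of u w] by (simp add: numeral_2_eq_2)
  have g: "inner_form (g y)" if y: "y \<in> S" for y
  proof -
    have lp: "linear (?p y)" by (rule linear_vproj[of G, OF G[OF y]])
    \<comment> \<open>This form without \<open>h\<close> gives bilinearity and symmetry. For
      positivity the orthogonal splitting below is used, as \<open>f y - 1\<close> may be
      negative.\<close>
    have eq: "g y u w = G y u w + (f y - 1) * \<kappa> y (?p y u) (?p y w)" for u w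
      unfolding g_eq[OF y] h[OF y] by (simp add: \<kappa>_def algebra_simps)
    note lin = linear_add[OF lp] linear_cmul[OF lp] bilinear_ladd[OF blG[OF y]] bilinear_radd[OF blG[OF y]]
      bilinear_lmul[OF blG[OF y]] bilinear_rmul[OF blG[OF y]] bilinear_ladd[OF bl\<kappa>[OF y]]
      bilinear_radd[OF bl\<kappa>[OF y]] bilinear_lmul[OF bl\<kappa>[OF y]] bilinear_rmul[OF bl\<kappa>[OF y]]
    have "bilinear (g y)"
      unfolding bilinear_def by (intro conjI allI linearI) (simp_all add: eq lin algebra_simps)
    moreover have "g y u w = g y w u" for u w
      using G[OF y] \<kappa>[OF y] unfolding eq inner_form_def by metis
    moreover have "g y u u > 0" if "u \<noteq> 0" for u
    proof -
      let ?u' = "u - (?p y u, 0)"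
      have split: "g y u u = f y * \<kappa> y (?p y u) (?p y u) + G y ?u' ?u'"
        using vproj_split[of G, OF G[OF y], of u u] by (simp add: g_eq[OF y] h[OF y])
      have nn: "\<kappa> y (?p y u) (?p y u) \<ge> 0" "G y ?u' ?u' \<ge> 0"
        using inner_form_nonneg \<kappa>[OF y] G[OF y] by blast+
      show ?thesis
      proof (cases "?p y u = 0")
        case True
        then have "?u' = u" by (simp add: prod_eq_iff)
        moreover have "G y u u > 0" using G[OF y] that unfolding inner_form_def by blast
        ultimately have "G y ?u' ?u' > 0" by (simp only:)
        then show ?thesis using split nn(1) fpos[of y] by (simp add: add_nonneg_pos)
      next
        case False
        then have "\<kappa> y (?p y u) (?p y u) > 0" using \<kappa>[OF y] unfolding inner_form_def by blast
        then show ?thesis using split nn(2) fpos[of y] by (simp add: add_pos_nonneg)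
      qed
    qed
    ultimately show ?thesis by (simp add: inner_form_def)
  qed
  interpret warped_chart S x \<kappa> ?p h g f
  proof (rule warped_chart.intro)
    show "h y (a, 0) w = 0" "h y w (a, 0) = 0" if "y \<in> S" for y a w
      using vproj_vertical[of G, OF G[OF that]] vproj[of G, OF G[OF that]] vproj'[of G, OF G[OF that]]
      by (simp_all add: h[OF that])
    show "dird (a, 0) (\<lambda>y. h y u w) y = 0" if "y \<in> S" for y a u w
      by (rule dird_constant_along_line[OF dh[OF that]]) (simp add: h_def)
    show "dird u f x = 0" for u
      using C_on_Suc_differentiable[of 1 S f x] Cf S(2) min
      by (intro dird_local_min[OF S]) (simp_all add: numeral_2_eq_2)
    show "linear (?p y)" if "y \<in> S" for y by (rule linear_vproj[of G, OF G[OF that]])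
  qed (simp_all add: S \<kappa> C\<kappa> G Cp vproj_vertical Ch Cf fpos g g_eq geodesic)
  show ?thesis
    using nonpositive_plane[OF assms(8) second_dird_local_min[OF S Cf min]] c(1) S(2)
    unfolding S_def g_def by blast
qed

end
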